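(* Let $\lambda>0$, $n\ge1$, $0<\beta<1$. Let $H_1^*,\dots,H_n^*$ be independent copies of $H^*(t)=\inf\{s\ge0:\ G^*(s)>t\}$, where $G^*$ is a $1/2$-stable subordinator with $\mathbb{E}[e^{-sG^*(t)}]=e^{-ts^{1/2}}$, and let $H_*^n(t)=H_1^*\circ\cdots\circ H_n^*(t)$. Let $D$ be a stable subordinator of index $\beta$ with $\mathbb{E}[e^{-sD(t)}]=e^{-ts^\beta}$ and $E(t)=\inf\{x\ge0:\ D(x)>t\}$ its inverse, and let $N$ be a Poisson process with rate $\lambda$, with $p_k(z)=\mathbb{P}(N(z)=k)$; assume $N,H_1^*,\dots,H_n^*,E$ are independent. Then the probability mass function $\tilde q_k(t)=\mathbb{P}(N(H_*^n(E(t)))=k)$, $k\ge0$, satisfies for $t>0$ $$\frac{d^\beta}{dt^\beta}\tilde q_k(t)=\lambda^{2^n}(1-\bigtriangledown)^{2^n}\tilde q_k(t)+\sum_{j=1}^{2^n-1}\left(\frac{\partial^j}{\partial z^j}p_k(z)\Big|_{z=0}\right)\left[\frac{t^{-\beta(2^n-j)/2^n}\,U\big((2^n-j)/2^n\big)}{\Gamma\!\left(1-\frac{2^n-j}{2^n}\right)}\right],$$ where $U(\gamma)=\mathbb{E}[D(1)^{\gamma\beta}]$ for $0<\gamma<1$.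
   Context: $\frac{d^\beta}{dt^\beta}$ is the Caputo fractional derivative of order $\beta\in(0,1)$: $\frac{d^\beta u(t)}{dt^\beta}=\frac{1}{\Gamma(1-\beta)}\int_0^t u'(r)\frac{dr}{(t-r)^\beta}$. $\bigtriangledown$ is the backward shift operator in the index $k$: $\bigtriangledown f_k=f_{k-1}$, with $f_i=0$ for $i<0$. The process $G^*$ is the inverse Gaussian subordinator $G(t)=\inf\{s>0:\ B(s)+\gamma_0 s>\delta t\}$ ($B$ standard Brownian motion) with $\delta=1/\sqrt2$, $\gamma_0=0$. The Poisson process has $p_k(z)=e^{-\lambda z}(\lambda z)^k/k!$. *)

theory Defs
  imports "HOL-Probability.Probability"
begin

text \<open>
  Stochastic processes are functions \<open>X t \<omega>\<close> of a real time \<open>t\<close>; only times \<open>t \<ge> 0\<close> matter.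
  Path properties are required almost surely.
\<close>

definition cadlag :: "(real \<Rightarrow> real) \<Rightarrow> bool" where
  "cadlag f \<longleftrightarrow>
     (\<forall>t\<ge>0. (f \<longlongrightarrow> f t) (at_right t)) \<and> (\<forall>t>0. \<exists>l. (f \<longlongrightarrow> l) (at_left t))"

text \<open>Stochastic continuity is implied by stationarity and right continuity of the paths.\<close>

definition levy_process :: "'a measure \<Rightarrow> (real \<Rightarrow> 'a \<Rightarrow> real) \<Rightarrow> bool" where
  "levy_process M X \<longleftrightarrow>
     (\<forall>t\<ge>0. X t \<in> borel_measurable M) \<and>
     (AE \<omega> in M. X 0 \<omega> = 0) \<and>
     (\<forall>(\<tau> :: nat \<Rightarrow> real) m. 0 \<le> \<tau> 0 \<longrightarrow> mono \<tau> \<longrightarrow>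
        prob_space.indep_vars M (\<lambda>_. borel) (\<lambda>i \<omega>. X (\<tau> (Suc i)) \<omega> - X (\<tau> i) \<omega>) {..<m}) \<and>
     (\<forall>s\<ge>0. \<forall>t\<ge>0. distr M borel (\<lambda>\<omega>. X (s + t) \<omega> - X s \<omega>) = distr M borel (X t)) \<and>
     (AE \<omega> in M. cadlag (\<lambda>t. X t \<omega>))"

definition subordinator :: "'a measure \<Rightarrow> (real \<Rightarrow> 'a \<Rightarrow> real) \<Rightarrow> bool" where
  "subordinator M X \<longleftrightarrow> levy_process M X \<and> (AE \<omega> in M. mono_on {0..} (\<lambda>t. X t \<omega>))"

definition stable_subordinator :: "'a measure \<Rightarrow> real \<Rightarrow> (real \<Rightarrow> 'a \<Rightarrow> real) \<Rightarrow> bool" where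
  "stable_subordinator M \<beta> X \<longleftrightarrow> subordinator M X \<and>
     (\<forall>s\<ge>0. \<forall>t\<ge>0. (\<integral>\<omega>. exp (- s * X t \<omega>) \<partial>M) = exp (- t * s powr \<beta>))"

definition poisson_prob :: "real \<Rightarrow> nat \<Rightarrow> real \<Rightarrow> real" where
  "poisson_prob c k z = exp (- c * z) * (c * z) ^ k / fact k"

definition poisson_process :: "'a measure \<Rightarrow> real \<Rightarrow> (real \<Rightarrow> 'a \<Rightarrow> nat) \<Rightarrow> bool" where
  "poisson_process M c N \<longleftrightarrow> levy_process M (\<lambda>t \<omega>. real (N t \<omega>)) \<and>
     (\<forall>z\<ge>0. \<forall>k. measure M {\<omega> \<in> space M. N z \<omega> = k} = poisson_prob c k z)"

definition inverse_process :: "(real \<Rightarrow> 'a \<Rightarrow> real) \<Rightarrow> real \<Rightarrow> 'a \<Rightarrow> real" where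
  "inverse_process X t \<omega> = Inf {s. 0 \<le> s \<and> t < X s \<omega>}"

text \<open>The pathwise composition \<open>H 1 \<circ> \<dots> \<circ> H n\<close>, with \<open>H n\<close> applied first.\<close>

primrec iterated_process ::
  "(nat \<Rightarrow> real \<Rightarrow> 'a \<Rightarrow> real) \<Rightarrow> nat \<Rightarrow> real \<Rightarrow> 'a \<Rightarrow> real" where
  "iterated_process H 0 t \<omega> = t"
| "iterated_process H (Suc n) t \<omega> = iterated_process H n (H (Suc n) t \<omega>) \<omega>"

text \<open>
  Independence of processes is independence of their paths as random elements of the product
  space over the time set \<open>{0..}\<close>.  The completion is needed because an inverse process is
  determined only up to a null set (where a path is irregular or bounded, its value is an
  unspecified real, which need not depend measurably on the sample point).
\<close>

definition independent_processes ::
  "'a measure \<Rightarrow> ('i \<Rightarrow> real \<Rightarrow> 'a \<Rightarrow> real) \<Rightarrow> 'i set \<Rightarrow> bool" where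
  "independent_processes M X I \<longleftrightarrow>
     prob_space.indep_vars (completion M) (\<lambda>_. \<Pi>\<^sub>M t\<in>{0..}. borel) (\<lambda>i \<omega>. \<lambda>t\<in>{0..}. X i t \<omega>) I"

text \<open>The operator acts on sequences indexed by \<open>k \<ge> 0\<close>, extended by zero to negative indices.\<close>

definition backward_shift :: "(nat \<Rightarrow> real) \<Rightarrow> nat \<Rightarrow> real" where
  "backward_shift f k = (if k = 0 then 0 else f (k - 1))"

definition one_minus_shift :: "(nat \<Rightarrow> real) \<Rightarrow> nat \<Rightarrow> real" where
  "one_minus_shift f k = f k - backward_shift f k"

text \<open>
  Since \<open>deriv\<close> and the Lebesgue integral are total, the existence of the Caputo derivative
  is a separate predicate.
\<close>

definition caputo_differentiable :: "real \<Rightarrow> (real \<Rightarrow> real) \<Rightarrow> real \<Rightarrow> bool" where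
  "caputo_differentiable \<beta> u t \<longleftrightarrow>
     (\<forall>r\<in>{0<..<t}. u differentiable (at r)) \<and>
     set_integrable lborel {0<..<t} (\<lambda>r. deriv u r / (t - r) powr \<beta>)"

definition caputo_deriv :: "real \<Rightarrow> (real \<Rightarrow> real) \<Rightarrow> real \<Rightarrow> real" where
  "caputo_deriv \<beta> u t =
     1 / Gamma (1 - \<beta>) * (LBINT r:{0<..<t}. deriv u r / (t - r) powr \<beta>)"

end

theory Submission
  imports Defs "HOL-Real_Asymp.Real_Asymp"
begin

text \<open>
  Put \<open>\<alpha> = \<beta> / 2 ^ n\<close> and let \<open>Z t\<close> be the composed time change.  For the inverse \<open>E\<close> of a \<open>\<beta>\<close>-stable
  subordinator, the Laplace transform in \<open>t\<close> of the expectation of \<open>\<phi> (E t)\<close> is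
  \<open>s powr (\<beta> - 1)\<close> times the Laplace transform of \<open>\<phi>\<close> at \<open>s powr \<beta>\<close>; under composition of
  independent processes the exponents multiply, so \<open>Z\<close> behaves like an inverse \<open>\<alpha>\<close>-stable subordinator.
  Uniqueness of Laplace transforms gives the moments \<open>j! t powr (\<alpha> j) / \<Gamma>(1 + \<alpha> j)\<close> of \<open>Z t\<close>, hence, with
  \<open>d j\<close> the \<open>j\<close>-th derivative of \<open>p\<^sub>k\<close> at \<open>0\<close>, the entire expansion
  \<open>q k t = (\<Sum>j. d j * t powr (\<alpha> j) / \<Gamma>(1 + \<alpha> j))\<close>.  The Caputo derivative of order \<open>\<beta>\<close> acts termwise by the
  beta integral and shifts the index by \<open>2 ^ n\<close>: the terms \<open>j \<ge> 2 ^ n\<close> reassemble to the operator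
  \<open>(1 - \<nabla>) ^ (2 ^ n)\<close> applied to \<open>q\<close>, and the terms \<open>1 \<le> j < 2 ^ n\<close> are the correction, because
  \<open>U \<gamma> = \<Gamma>(1 - \<gamma>) / \<Gamma>(1 - \<gamma> \<beta>)\<close>.
\<close>

subsection \<open>Laplace transforms\<close>

text \<open>Two obstacles shape the proof. Independence concerns paths as points of a product over
  the uncountable set \<open>{0..}\<close>, where joint evaluation at a random time is not
  measurable; \<open>path_at\<close> reads a path at countably many grid times only and agrees with
  evaluation on right continuous paths, so that conditioning on an independent time becomes Fubini.
  Moreover, uniqueness of Laplace transforms gives equality only for almost every \<open>t\<close>;
  the moments are monotone in \<open>t\<close> and their candidates are continuous, which gives
  every \<open>t > 0\<close>. The law of an inverse \<open>H\<close> of \<open>G\<close> enters only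
  through the Laplace transform of \<open>G x\<close>: the event \<open>x < H t\<close> lies between
  \<open>G x < t\<close> and \<open>G x \<le> t\<close>, whose probabilities have the same transform
  in \<open>t\<close>. Working in \<open>ennreal\<close> avoids integrability questions up to the
  final expansion. Each half-stable inverse contributes a factor 1/2 to \<open>\<alpha>\<close> and
  \<open>E\<close> contributes \<open>\<beta>\<close>, so \<open>\<beta>\<close> is exactly
  \<open>2 ^ n\<close> steps of \<open>\<alpha>\<close>; this is why a fractional derivative becomes
  an integer shift of the index.\<close>

definition laplace :: "(real \<Rightarrow> ennreal) \<Rightarrow> real \<Rightarrow> ennreal" where
  "laplace f s = (\<integral>\<^sup>+t\<in>{0<..}. f t * ennreal (exp (- s * t)) \<partial>lborel)"

lemma laplace_powr:
  fixes a s :: real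
  assumes a: "a > 0" and s: "s > 0"
  shows "laplace (\<lambda>t. ennreal (t powr (a - 1))) s = ennreal (Gamma a / s powr a)"
proof -
  have "ennreal (Gamma a) = (\<integral>\<^sup>+t. ennreal (indicator {0..} t * t powr (a - 1) / exp t) \<partial>lborel)"
    using nn_integral_has_integral_lebesgue[OF _ Gamma_integral_real[OF a]] by simp
  also have "\<dots> = \<bar>s\<bar> * (\<integral>\<^sup>+t. ennreal (indicator {0..} (0 + s * t) * (0 + s * t) powr (a - 1) / exp (0 + s * t)) \<partial>lborel)"
    by (rule nn_integral_real_affine) (use s in auto)
  also have "(\<integral>\<^sup>+t. ennreal (indicator {0..} (0 + s * t) * (0 + s * t) powr (a - 1) / exp (0 + s * t)) \<partial>lborel)
    = (\<integral>\<^sup>+t. ennreal (s powr (a - 1)) * (ennreal (t powr (a - 1)) * ennreal (exp (- s * t)) * indicator {0<..} t) \<partial>lborel)"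
  proof (rule nn_integral_cong_AE, use AE_lborel_singleton[of 0] in eventually_elim)
    fix t :: real assume t: "t \<noteq> 0"
    show "ennreal (indicator {0..} (0 + s * t) * (0 + s * t) powr (a - 1) / exp (0 + s * t))
      = ennreal (s powr (a - 1)) * (ennreal (t powr (a - 1)) * ennreal (exp (- s * t)) * indicator {0<..} t)"
    proof (cases "t > 0")
      case True
      then show ?thesis using s
        by (simp add: powr_mult exp_minus divide_inverse mult_ac flip: ennreal_mult')
    next
      case False
      then have "t < 0" using t by simp
      then have "\<not> 0 \<le> s * t" using s by (simp add: zero_le_mult_iff)
      then show ?thesis using False by simp
    qed
  qed
  also have "\<dots> = ennreal (s powr (a - 1)) * laplace (\<lambda>t. ennreal (t powr (a - 1))) s"
    unfolding laplace_def by (subst nn_integral_cmult) auto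
  finally have *: "ennreal (Gamma a) = ennreal (s powr a) * laplace (\<lambda>t. ennreal (t powr (a - 1))) s"
    using s by (simp add: mult.assoc[symmetric] powr_diff flip: ennreal_mult')
  have "laplace (\<lambda>t. ennreal (t powr (a - 1))) s = ennreal (1 / s powr a) * (ennreal (s powr a) * laplace (\<lambda>t. ennreal (t powr (a - 1))) s)"
    using s by (simp add: mult.assoc[symmetric] flip: ennreal_mult')
  also have "\<dots> = ennreal (Gamma a / s powr a)"
    unfolding *[symmetric] by (simp flip: ennreal_mult')
  finally show ?thesis .
qed

text \<open>On \<open>{-1..1}\<close> the exponential series is dominated by that of
  \<open>exp \<bar>x\<bar>\<close>, uniformly in \<open>y\<close>, so sum and integral may be
  exchanged. The right-hand side sees \<open>M\<close> only through its moments.\<close>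

lemma char_bounded_support:
  assumes "real_distribution M" and bd: "AE y in M. \<bar>y\<bar> \<le> 1"
  shows "char M x = (\<Sum>n. (\<i> * x) ^ n / fact n * of_real (\<integral>y. y ^ n \<partial>M))"
proof -
  interpret real_distribution M by fact
  have int: "integrable M (\<lambda>y. (y::real) ^ n)" for n
    by (rule integrable_const_bound[where B=1])
       (use bd in \<open>auto simp: power_abs power_le_one elim!: eventually_mono\<close>)
  let ?f = "\<lambda>n y. (\<i> * x) ^ n / fact n * of_real (y ^ n)"
  have nf: "norm (?f n y) = \<bar>x\<bar> ^ n / fact n * \<bar>y\<bar> ^ n" for n y
    by (simp add: norm_mult norm_divide norm_power power_mult_distrib)
  have sm: "summable (\<lambda>n. \<bar>x\<bar> ^ n / fact n * B)" for B
    using summable_exp[of "\<bar>x\<bar>"] by (intro summable_mult2) (simp add: field_simps)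
  have le: "norm (?f n y) \<le> \<bar>x\<bar> ^ n / fact n * 1" if "\<bar>y\<bar> \<le> 1" for n y
    unfolding nf using that by (intro mult_left_mono power_le_one) auto
  have sums: "(\<Sum>n. ?f n y) = iexp (x * y)" for y
  proof -
    have "?f n y = (\<i> * (x * y)) ^ n /\<^sub>R fact n" for n
      by (simp add: power_mult_distrib scaleR_conv_of_real field_simps)
    then show ?thesis unfolding exp_def by simp
  qed
  have "char M x = (\<integral>y. (\<Sum>n. ?f n y) \<partial>M)"
    unfolding sums char_def ..
  also have "\<dots> = (\<Sum>n. \<integral>y. ?f n y \<partial>M)"
  proof (rule integral_suminf)
    show "integrable M (?f n)" for n using int[of n] by (intro integrable_mult_right integrable_of_real)
    show "AE y in M. summable (\<lambda>n. norm (?f n y))"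
      using bd
    proof eventually_elim
      case (elim y)
      then show ?case
        by (intro summable_comparison_test'[OF sm[of 1], of 0]) (use le[of y] in auto)
    qed
    show "summable (\<lambda>n. \<integral>y. norm (?f n y) \<partial>M)"
    proof (rule summable_comparison_test'[OF sm[of 1], of 0])
      fix n
      have "(\<integral>y. norm (?f n y) \<partial>M) \<le> (\<integral>y. \<bar>x\<bar> ^ n / fact n * 1 \<partial>M)"
        using bd int[of n]
        by (intro integral_mono_AE integrable_norm integrable_mult_right integrable_of_real)
           (auto elim!: eventually_mono dest: le)
      then show "norm (\<integral>y. norm (?f n y) \<partial>M) \<le> \<bar>x\<bar> ^ n / fact n * 1"
        using prob_space by simp
    qed
  qed
  also have "\<dots> = (\<Sum>n. (\<i> * x) ^ n / fact n * of_real (\<integral>y. y ^ n \<partial>M))"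
    by (subst integral_mult_right_zero, subst integral_complex_of_real) rule
  finally show ?thesis .
qed

text \<open>Determinacy of the moment problem on a bounded interval: equal moments give equal
  characteristic functions.\<close>

lemma moments_unique:
  assumes "real_distribution M" "AE y in M. \<bar>y\<bar> \<le> 1"
    and "real_distribution N" "AE y in N. \<bar>y\<bar> \<le> 1"
    and "\<And>n. (\<integral>y. y ^ n \<partial>M) = (\<integral>y. y ^ n \<partial>N)"
  shows "M = N"
  using assms by (intro Levy_uniqueness) (auto simp: char_bounded_support fun_eq_iff)

text \<open>Substituting \<open>y = exp (- t)\<close> turns the values at the positive integers into the moments of a
  distribution on \<open>{0..1}\<close>.\<close>

lemma laplace_unique:
  assumes f[measurable]: "f \<in> borel_measurable borel" and g[measurable]: "g \<in> borel_measurable borel"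
    and eq: "\<And>s. s > 0 \<Longrightarrow> laplace f s = laplace g s"
    and fin: "laplace f 1 < \<infinity>"
  shows "AE t in lborel. t > 0 \<longrightarrow> f t = g t"
proof (cases "laplace f 1 = 0")
  \<comment> \<open>Zero mass cannot be normalised to a probability; here both functions vanish
    almost everywhere on the positive axis.\<close>
  case True
  then have "laplace g 1 = 0" using eq[of 1] by simp
  with True have "AE t in lborel. f t * ennreal (exp (- 1 * t)) * indicator {0<..} t = 0"
    "AE t in lborel. g t * ennreal (exp (- 1 * t)) * indicator {0<..} t = 0"
    unfolding laplace_def by (simp_all add: nn_integral_0_iff_AE)
  then show ?thesis
    by eventually_elim (auto simp: indicator_def)
next
  case False
  define C where "C = laplace f 1"
  have C: "C \<noteq> 0" "C \<noteq> \<infinity>" "C < top" using False fin by (auto simp: C_def)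
  \<comment> \<open>The damping \<open>exp (- t)\<close> gives mass \<open>C\<close>, and the same
    \<open>C\<close> normalises \<open>g\<close> because the transforms agree at 1. The n-th moment
    of \<open>W h\<close> is then the transform of \<open>h\<close> at \<open>1 + n\<close>, divided
    by \<open>C\<close>.\<close>
  define w where "w h t = h t * ennreal (exp (- 1 * t)) * indicator {0<..} t / C" for h and t :: real
  define W where "W h = distr (density lborel (w h)) borel (\<lambda>t. exp (- t))" for h
  have w[measurable]: "w h \<in> borel_measurable borel" if "h \<in> borel_measurable borel" for h
    using that unfolding w_def by measurable
  have lap: "(\<integral>\<^sup>+t. w h t * ennreal (exp (- t) ^ n) \<partial>lborel) = laplace h (1 + real n) / C"
    if [measurable]: "h \<in> borel_measurable borel" for h n
  proof -
    have "w h t * ennreal (exp (- t) ^ n) = h t * ennreal (exp (- (1 + real n) * t)) * indicator {0<..} t / C" for t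
    proof -
      have "ennreal (exp (- (1 + real n) * t)) = ennreal (exp (- 1 * t)) * ennreal (exp (- t) ^ n)"
        by (simp add: exp_of_nat_mult[symmetric] exp_add[symmetric] algebra_simps flip: ennreal_mult')
      then show ?thesis unfolding w_def by (simp add: divide_ennreal_def mult_ac)
    qed
    then show ?thesis unfolding laplace_def
      by (simp add: nn_integral_divide)
  qed
  have mom: "(\<integral>\<^sup>+y. ennreal (y ^ n) \<partial>W h) = laplace h (1 + real n) / C"
    if [measurable]: "h \<in> borel_measurable borel" for h n
    unfolding W_def by (subst nn_integral_distr) (auto simp: nn_integral_density lap)
  have AEW: "AE y in W h. 0 \<le> y \<and> \<bar>y\<bar> \<le> 1" if [measurable]: "h \<in> borel_measurable borel" for h
    unfolding W_def by (subst AE_distr_iff) (auto simp: AE_density w_def indicator_def)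
  have dist: "real_distribution (W h)" if [measurable]: "h \<in> borel_measurable borel" and "laplace h 1 = C" for h
  proof -
    have "emeasure (W h) (space (W h)) = (\<integral>\<^sup>+y. ennreal (y ^ 0) \<partial>W h)" by simp
    also have "\<dots> = 1" unfolding mom[OF that(1)] using that C by (simp add: ennreal_divide_self)
    finally have "prob_space (W h)" by (rule prob_spaceI)
    then show ?thesis unfolding real_distribution_def real_distribution_axioms_def
      by (simp add: W_def)
  qed
  have "W f = W g"
  proof (rule moments_unique)
    show "real_distribution (W f)" "real_distribution (W g)"
      using eq[of 1] by (auto intro!: dist simp: C_def)
    show "AE y in W f. \<bar>y\<bar> \<le> 1" "AE y in W g. \<bar>y\<bar> \<le> 1"
      using AEW[OF f] AEW[OF g] by auto
    show "(\<integral>y. y ^ n \<partial>W f) = (\<integral>y. y ^ n \<partial>W g)" for n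
    proof -
      have "(\<integral>y. y ^ n \<partial>W h) = enn2real (laplace h (1 + real n) / C)"
        if [measurable]: "h \<in> borel_measurable borel" for h
        unfolding mom[OF that, symmetric]
        by (rule integral_eq_nn_integral) (use AEW[OF that] in \<open>auto simp: W_def elim!: eventually_mono\<close>)
      then show ?thesis using eq[of "1 + real n"] by simp
    qed
  qed
  \<comment> \<open>The substitution is invertible: pushing forward by \<open>- ln\<close> recovers
    the density, and equal measures have densities equal almost everywhere.\<close>
  moreover have "distr (W h) borel (\<lambda>y. - ln y) = density lborel (w h)"
    if [measurable]: "h \<in> borel_measurable borel" for h
  proof -
    have "distr (W h) borel (\<lambda>y. - ln y) = distr (density lborel (w h)) borel (\<lambda>t. t)"
      unfolding W_def by (subst distr_distr) (auto simp: comp_def)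
    also have "\<dots> = density lborel (w h)"
      by (intro distr_id2) auto
    finally show ?thesis .
  qed
  ultimately have "density lborel (w f) = density lborel (w g)"
    using f g by metis
  then have "AE t in lborel. w f t = w g t"
    by (intro sigma_finite_measure.density_unique lborel.sigma_finite_measure_axioms) auto
  then show ?thesis
  proof eventually_elim
    case (elim t)
    show ?case
    proof
      assume t: "t > 0"
      have "w h t * (C * ennreal (exp t)) = h t" for h
      proof -
        have "w h t * (C * ennreal (exp t)) = h t * (ennreal (exp (- t)) * ennreal (exp t)) * (C / C)"
          using t by (simp add: w_def divide_ennreal_def mult_ac)
        also have "ennreal (exp (- t)) * ennreal (exp t) = 1"
          by (simp add: exp_minus flip: ennreal_mult')
        finally show ?thesis using C by (simp add: ennreal_divide_self)
      qed
      then show "f t = g t" using elim by metis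
    qed
  qed
qed

subsection \<open>Gamma and beta integrals\<close>

lemma nn_integral_exp_atLeast:
  assumes s: "s > (0::real)"
  shows "(\<integral>\<^sup>+t\<in>{a..}. ennreal (exp (- s * t)) \<partial>lborel) = ennreal (exp (- s * a) / s)"
proof -
  have "(\<integral>\<^sup>+t. ennreal (exp (- s * t)) * indicator {a..} t \<partial>lborel) = 0 - (- exp (- s * a) / s)"
  proof (rule nn_integral_FTC_atLeast)
    show "((\<lambda>t. - exp (- s * t) / s) has_real_derivative exp (- s * t)) (at t)" for t
      using s by (auto intro!: derivative_eq_intros)
    have "((\<lambda>t. exp (- s * t)) \<longlongrightarrow> 0) at_top"
      using s by real_asymp
    from tendsto_divide[OF tendsto_minus[OF this] tendsto_const, of s]
    show "((\<lambda>t. - exp (- s * t) / s) \<longlongrightarrow> 0) at_top" using s by simp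
  qed auto
  then show ?thesis by simp
qed

lemma nn_integral_powr_tail:
  assumes r: "r > (0::real)" and a: "a > 0"
  shows "(\<integral>\<^sup>+s\<in>{a..}. ennreal (s powr (- r - 1)) \<partial>lborel) = ennreal (a powr (- r) / r)"
proof -
  have "(\<integral>\<^sup>+s. ennreal (s powr (- r - 1)) * indicator {a..} s \<partial>lborel) = 0 - (- (a powr (- r)) / r)"
  proof (rule nn_integral_FTC_atLeast)
    show "((\<lambda>t. - (t powr (- r)) / r) has_real_derivative s powr (- r - 1)) (at s)" if "a \<le> s" for s
      using r a that by (auto intro!: derivative_eq_intros)
    have "((\<lambda>t. t powr (- r)) \<longlongrightarrow> 0) at_top"
      using r by real_asymp
    from tendsto_divide[OF tendsto_minus[OF this] tendsto_const, of r]
    show "((\<lambda>t. - (t powr (- r)) / r) \<longlongrightarrow> 0) at_top" using r by simp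
  qed auto
  then show ?thesis by simp
qed

text \<open>Written as an integral of a nonnegative function, \<open>1 - exp (- z)\<close> becomes
  accessible to Tonelli in the Frullani-type integral.\<close>

lemma ennreal_one_minus_exp:
  assumes "z \<ge> (0::real)"
  shows "ennreal (1 - exp (- z)) = (\<integral>\<^sup>+y\<in>{0..z}. ennreal (exp (- y)) \<partial>lborel)"
proof -
  have "(\<integral>\<^sup>+y. ennreal (exp (- y)) * indicator {0..z} y \<partial>lborel) = - exp (- z) - (- exp (- 0))"
    by (rule nn_integral_FTC_Icc) (use assms in \<open>auto intro!: derivative_eq_intros\<close>)
  then show ?thesis by simp
qed

text \<open>The cases \<open>b = 1\<close> and \<open>x = 1\<close> are the two sides of the fractional moment formula below.\<close>

lemma nn_integral_frullani_powr:
  fixes b r x :: real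
  assumes b: "b > 0" and r: "0 < r" "r < b" and x: "x \<ge> 0"
  shows "(\<integral>\<^sup>+s\<in>{0<..}. ennreal ((1 - exp (- (s powr b * x))) * s powr (- r - 1)) \<partial>lborel)
    = ennreal (x powr (r / b) * Gamma (1 - r / b) / r)"
proof (cases "x = 0")
  case True
  then show ?thesis by simp
next
  case False
  with x have x: "x > 0" by simp
  \<comment> \<open>Solving the constraint for \<open>s\<close> prepares the exchange of integrals:
    for fixed \<open>y\<close> the integral over \<open>s\<close> is a pure power tail, and what
    remains in \<open>y\<close> is Euler's integral at \<open>1 - r / b\<close>, positive because
    \<open>r < b\<close>.\<close>
  have cond: "y \<le> s powr b * x \<longleftrightarrow> (y / x) powr (1 / b) \<le> s" if "s > 0" "y > 0" for s y
  proof -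
    have "y \<le> s powr b * x \<longleftrightarrow> y / x \<le> s powr b"
      using x by (simp add: pos_divide_le_eq)
    also have "\<dots> \<longleftrightarrow> (y / x) powr (1 / b) \<le> (s powr b) powr (1 / b)"
      using that x b by (meson divide_nonneg_pos divide_pos_pos less_imp_le not_le powr_ge_zero powr_less_mono2 powr_mono2 zero_less_one zero_less_divide_1_iff)
    also have "(s powr b) powr (1 / b) = s"
      using that b by (simp add: powr_powr)
    finally show ?thesis .
  qed
  have "(\<integral>\<^sup>+s\<in>{0<..}. ennreal ((1 - exp (- (s powr b * x))) * s powr (- r - 1)) \<partial>lborel)
    = (\<integral>\<^sup>+s. (\<integral>\<^sup>+y. ennreal (exp (- y)) * indicator {0..s powr b * x} y * (ennreal (s powr (- r - 1)) * indicator {0<..} s) \<partial>lborel) \<partial>lborel)"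
    using x by (subst nn_integral_multc)
      (auto simp: ennreal_one_minus_exp[symmetric] mult_ac ennreal_mult' intro!: nn_integral_cong)
  also have "\<dots> = (\<integral>\<^sup>+y. (\<integral>\<^sup>+s. ennreal (exp (- y)) * indicator {0..s powr b * x} y * (ennreal (s powr (- r - 1)) * indicator {0<..} s) \<partial>lborel) \<partial>lborel)"
    by (rule lborel_pair.Fubini') (simp add: indicator_def)
  also have "\<dots> = (\<integral>\<^sup>+y. ennreal (x powr (r / b) / r) * (ennreal (y powr (1 - r / b - 1)) * ennreal (exp (- 1 * y)) * indicator {0<..} y) \<partial>lborel)"
  proof (rule nn_integral_cong_AE, use AE_lborel_singleton[of 0] in eventually_elim)
    fix y :: real assume y0: "y \<noteq> 0"
    show "(\<integral>\<^sup>+s. ennreal (exp (- y)) * indicator {0..s powr b * x} y * (ennreal (s powr (- r - 1)) * indicator {0<..} s) \<partial>lborel)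
      = ennreal (x powr (r / b) / r) * (ennreal (y powr (1 - r / b - 1)) * ennreal (exp (- 1 * y)) * indicator {0<..} y)"
    proof (cases "y > 0")
      case False
      then show ?thesis using y0 by simp
    next
      case True
      have "(\<integral>\<^sup>+s. ennreal (exp (- y)) * indicator {0..s powr b * x} y * (ennreal (s powr (- r - 1)) * indicator {0<..} s) \<partial>lborel)
        = (\<integral>\<^sup>+s. ennreal (exp (- y)) * (ennreal (s powr (- r - 1)) * indicator {(y / x) powr (1 / b)..} s) \<partial>lborel)"
      proof (rule nn_integral_cong)
        fix s :: real
        have "0 < (y / x) powr (1 / b)" using True x by simp
        then have "(y / x) powr (1 / b) \<le> s \<Longrightarrow> 0 < s" by linarith
        then show "ennreal (exp (- y)) * indicator {0..s powr b * x} y * (ennreal (s powr (- r - 1)) * indicator {0<..} s)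
          = ennreal (exp (- y)) * (ennreal (s powr (- r - 1)) * indicator {(y / x) powr (1 / b)..} s)"
          using True cond[of s y] by (cases "s > 0") (auto simp: indicator_def)
      qed
      also have "\<dots> = ennreal (exp (- y)) * ennreal (((y / x) powr (1 / b)) powr (- r) / r)"
        using True x r by (subst nn_integral_cmult) (auto simp: nn_integral_powr_tail)
      also have "((y / x) powr (1 / b)) powr (- r) / r = x powr (r / b) / r * y powr (1 - r / b - 1)"
        using True x by (simp add: powr_powr powr_divide powr_minus field_simps)
      finally show ?thesis using True r
        by (simp add: mult_ac flip: ennreal_mult')
    qed
  qed
  also have "\<dots> = ennreal (x powr (r / b) / r) * laplace (\<lambda>y. ennreal (y powr (1 - r / b - 1))) 1"
    unfolding laplace_def by (rule nn_integral_cmult) auto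
  also have "\<dots> = ennreal (x powr (r / b) * Gamma (1 - r / b) / r)"
    using r b by (subst laplace_powr) (auto simp flip: ennreal_mult')
  finally show ?thesis .
qed

lemma nn_integral_Beta_scaled:
  fixes a b t :: real
  assumes a: "a > 0" and b: "b > 0" and t: "t > 0"
  shows "(\<integral>\<^sup>+r\<in>{0<..<t}. ennreal (r powr (a - 1) * (t - r) powr (b - 1)) \<partial>lborel)
    = ennreal (t powr (a + b - 1) * Beta a b)"
proof -
  have B: "(\<integral>\<^sup>+u. ennreal (indicator {0..1} u * (u powr (a - 1) * (1 - u) powr (b - 1))) \<partial>lborel) = ennreal (Beta a b)"
    using nn_integral_has_integral_lebesgue[OF _ has_integral_Beta_real[OF a b]] by simp
  have "(\<integral>\<^sup>+r\<in>{0<..<t}. ennreal (r powr (a - 1) * (t - r) powr (b - 1)) \<partial>lborel)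
    = \<bar>t\<bar> * (\<integral>\<^sup>+u. ennreal ((0 + t * u) powr (a - 1) * (t - (0 + t * u)) powr (b - 1)) * indicator {0<..<t} (0 + t * u) \<partial>lborel)"
    by (rule nn_integral_real_affine) (use t in auto)
  also have "(\<integral>\<^sup>+u. ennreal ((0 + t * u) powr (a - 1) * (t - (0 + t * u)) powr (b - 1)) * indicator {0<..<t} (0 + t * u) \<partial>lborel)
    = (\<integral>\<^sup>+u. ennreal (t powr (a + b - 2)) * ennreal (indicator {0..1} u * (u powr (a - 1) * (1 - u) powr (b - 1))) \<partial>lborel)"
  proof (rule nn_integral_cong_AE, use AE_lborel_singleton[of 0] AE_lborel_singleton[of 1] in eventually_elim)
    fix u :: real assume u: "u \<noteq> 0" "u \<noteq> 1"
    show "ennreal ((0 + t * u) powr (a - 1) * (t - (0 + t * u)) powr (b - 1)) * indicator {0<..<t} (0 + t * u)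
      = ennreal (t powr (a + b - 2)) * ennreal (indicator {0..1} u * (u powr (a - 1) * (1 - u) powr (b - 1)))"
    proof (cases "0 < u \<and> u < 1")
      case True
      have "t - t * u = t * (1 - u)" by (simp add: algebra_simps)
      moreover have "t powr (a + b - 2) = t powr (a - 1) * t powr (b - 1)"
        by (simp flip: powr_add)
      ultimately show ?thesis using True t
        by (simp add: powr_mult mult_ac flip: ennreal_mult')
    next
      case False
      then have "\<not> (0 < t * u \<and> t * u < t)" "u \<notin> {0..1}"
        using t u by (auto simp: zero_less_mult_iff)
      then show ?thesis by (auto simp: indicator_def)
    qed
  qed
  also have "\<dots> = ennreal (t powr (a + b - 2)) * ennreal (Beta a b)"
    by (subst nn_integral_cmult) (auto simp: B)
  also have "ennreal \<bar>t\<bar> * \<dots> = ennreal (t * t powr (a + b - 2) * Beta a b)"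
    using t by (simp add: mult.assoc flip: ennreal_mult')
  also have "t * t powr (a + b - 2) = t powr (a + b - 1)"
    using t by (simp add: powr_mult_base)
  finally show ?thesis .
qed

text \<open>Restrict Euler's integral to \<open>{R..}\<close>, where
  \<open>t powr x \<ge> R powr x\<close>. As \<open>R\<close> is free, this gives growth beyond
  every exponential without Stirling's formula.\<close>

lemma Gamma_real_lower_bound:
  fixes x R :: real
  assumes x: "x \<ge> 0" and R: "R > 0"
  shows "R powr x * exp (- R) \<le> Gamma (1 + x)"
proof -
  have "ennreal (R powr x * exp (- R)) = (\<integral>\<^sup>+t. ennreal (R powr x) * (ennreal (exp (- 1 * t)) * indicator {R..} t) \<partial>lborel)"
    using nn_integral_exp_atLeast[of 1 R] by (subst nn_integral_cmult) (auto simp flip: ennreal_mult')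
  also have "\<dots> \<le> laplace (\<lambda>t. ennreal (t powr ((1 + x) - 1))) 1"
    unfolding laplace_def
    by (intro nn_integral_mono)
       (use x R in \<open>auto simp: indicator_def powr_mono2 intro!: ennreal_leI mult_right_mono simp flip: ennreal_mult'\<close>)
  also have "\<dots> = ennreal (Gamma (1 + x))"
    using x by (subst laplace_powr) auto
  finally show ?thesis using x by (simp add: Gamma_real_pos less_imp_le)
qed

lemma summable_mittag_leffler:
  fixes \<alpha> x :: real
  assumes \<alpha>: "\<alpha> > 0"
  shows "summable (\<lambda>j. x ^ j / Gamma (1 + \<alpha> * real j))"
proof -
  \<comment> \<open>Chosen so that \<open>R powr \<alpha> = 2 * (\<bar>x\<bar> + 1)\<close>: the
    Gamma bound then beats the numerator by \<open>2 ^ j\<close>, and the added 1 keeps the base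
    positive when \<open>x = 0\<close>.\<close>
  define R where "R = (2 * (\<bar>x\<bar> + 1)) powr (1 / \<alpha>)"
  have R: "R > 0" "R powr \<alpha> = 2 * (\<bar>x\<bar> + 1)"
    using \<alpha> by (auto simp: R_def powr_powr)
  have Rj: "R powr (\<alpha> * real j) = (2 * (\<bar>x\<bar> + 1)) ^ j" for j
    using R by (simp add: powr_powr[symmetric] powr_realpow)
  show ?thesis
  proof (rule summable_comparison_test'[of "\<lambda>j. exp R * (1 / 2) ^ j" 0])
    show "summable (\<lambda>j. exp R * (1 / 2 :: real) ^ j)"
      by (intro summable_mult summable_geometric) auto
    fix j :: nat
    have G: "(2 * (\<bar>x\<bar> + 1)) ^ j * exp (- R) \<le> Gamma (1 + \<alpha> * real j)"
      using Gamma_real_lower_bound[of "\<alpha> * real j" R] \<alpha> R(1) by (simp add: Rj)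
    have pos: "0 < (2 * (\<bar>x\<bar> + 1)) ^ j * exp (- R)"
      by simp
    have "norm (x ^ j / Gamma (1 + \<alpha> * real j)) = \<bar>x\<bar> ^ j / Gamma (1 + \<alpha> * real j)"
      using less_le_trans[OF pos G] by (simp add: abs_divide power_abs)
    also have "\<dots> \<le> (\<bar>x\<bar> + 1) ^ j / ((2 * (\<bar>x\<bar> + 1)) ^ j * exp (- R))"
      using pos G by (intro frac_le power_mono) auto
    also have "\<dots> = exp R * (1 / 2) ^ j"
      unfolding power_mult_distrib[of 2] by (simp add: exp_minus power_divide divide_simps)
    finally show "norm (x ^ j / Gamma (1 + \<alpha> * real j)) \<le> exp R * (1 / 2) ^ j" .
  qed
qed

subsection \<open>Fractional moments and inversion of power laws\<close>

text \<open>A power \<open>X powr r\<close> is a mixture over \<open>s\<close>, with weight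
  \<open>s powr (- r - 1)\<close>, of the variables \<open>1 - exp (- s * X)\<close>, whose means
  are known. Tonelli moves the expectation inside, and \<open>r < b < 1\<close> keeps both Gamma
  arguments positive.\<close>

lemma stable_fractional_moment:
  assumes "prob_space M" and X[measurable]: "X \<in> borel_measurable M" and nonneg: "AE \<omega> in M. 0 \<le> X \<omega>"
    and lap: "\<And>s. s \<ge> 0 \<Longrightarrow> (\<integral>\<omega>. exp (- s * X \<omega>) \<partial>M) = exp (- (s powr b))"
    and r: "0 < r" "r < b" and b: "b < (1::real)"
  shows "(\<integral>\<omega>. X \<omega> powr r \<partial>M) = Gamma (1 - r / b) / Gamma (1 - r)"
proof -
  interpret prob_space M by fact
  interpret pair_sigma_finite M lborel ..
  have G: "Gamma (1 - r) > 0" "Gamma (1 - r / b) > 0"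
    using r b by (auto intro!: Gamma_real_pos)
  have ie: "integrable M (\<lambda>\<omega>. exp (- s * X \<omega>))" if "s \<ge> 0" for s
    by (rule integrable_const_bound[where B=1]) (use nonneg that in \<open>auto elim!: eventually_mono\<close>)
  have one: "(\<integral>\<^sup>+\<omega>. ennreal (1 - exp (- (s * X \<omega>))) \<partial>M) = ennreal (1 - exp (- (s powr b * 1)))" if s: "s \<ge> 0" for s
  proof -
    have "(\<integral>\<^sup>+\<omega>. ennreal (1 - exp (- (s * X \<omega>))) \<partial>M) = ennreal (\<integral>\<omega>. 1 - exp (- s * X \<omega>) \<partial>M)"
      using ie[OF s] nonneg s by (subst nn_integral_eq_integral) (auto elim!: eventually_mono)
    also have "(\<integral>\<omega>. 1 - exp (- s * X \<omega>) \<partial>M) = 1 - exp (- (s powr b))"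
      using ie[OF s] lap[OF s] by (subst Bochner_Integration.integral_diff) (auto simp: prob_space)
    finally show ?thesis by simp
  qed
  have "ennreal (Gamma (1 - r) / r) * (\<integral>\<^sup>+\<omega>. ennreal (X \<omega> powr r) \<partial>M)
      = (\<integral>\<^sup>+\<omega>. ennreal (X \<omega> powr (r / 1) * Gamma (1 - r / 1) / r) \<partial>M)"
    using G r by (subst nn_integral_cmult[symmetric]) (auto simp: mult_ac simp flip: ennreal_mult' intro!: nn_integral_cong)
  also have "\<dots> = (\<integral>\<^sup>+\<omega>. (\<integral>\<^sup>+s. ennreal ((1 - exp (- (s * X \<omega>))) * s powr (- r - 1)) * indicator {0<..} s \<partial>lborel) \<partial>M)"
  proof (rule nn_integral_cong_AE, use nonneg in eventually_elim)
    case (elim \<omega>)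
    show ?case
      by (subst nn_integral_frullani_powr[symmetric])
         (use r b elim in \<open>auto intro!: nn_integral_cong simp: indicator_def\<close>)
  qed
  also have "\<dots> = (\<integral>\<^sup>+s. (\<integral>\<^sup>+\<omega>. ennreal ((1 - exp (- (s * X \<omega>))) * s powr (- r - 1)) * indicator {0<..} s \<partial>M) \<partial>lborel)"
    by (rule Fubini'[symmetric]) (simp add: split_beta')
  also have "\<dots> = (\<integral>\<^sup>+s. ennreal ((1 - exp (- (s powr b * 1))) * s powr (- r - 1)) * indicator {0<..} s \<partial>lborel)"
  proof (rule nn_integral_cong)
    fix s :: real
    have "(\<integral>\<^sup>+\<omega>. ennreal ((1 - exp (- (s * X \<omega>))) * s powr (- r - 1)) * indicator {0<..} s \<partial>M)
      = (\<integral>\<^sup>+\<omega>. ennreal (1 - exp (- (s * X \<omega>))) * (ennreal (s powr (- r - 1)) * indicator {0<..} s) \<partial>M)"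
      by (simp add: ennreal_mult'' mult.assoc)
    also have "\<dots> = (\<integral>\<^sup>+\<omega>. ennreal (1 - exp (- (s * X \<omega>))) \<partial>M) * (ennreal (s powr (- r - 1)) * indicator {0<..} s)"
      by (rule nn_integral_multc) simp
    also have "\<dots> = ennreal ((1 - exp (- (s powr b * 1))) * s powr (- r - 1)) * indicator {0<..} s"
      using one[of s] by (auto simp: indicator_def ennreal_mult'')
    finally show "(\<integral>\<^sup>+\<omega>. ennreal ((1 - exp (- (s * X \<omega>))) * s powr (- r - 1)) * indicator {0<..} s \<partial>M)
      = ennreal ((1 - exp (- (s powr b * 1))) * s powr (- r - 1)) * indicator {0<..} s" .
  qed
  also have "\<dots> = ennreal (Gamma (1 - r / b) / r)"
    using r by (subst nn_integral_frullani_powr) auto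
  finally have *: "ennreal (Gamma (1 - r) / r) * (\<integral>\<^sup>+\<omega>. ennreal (X \<omega> powr r) \<partial>M) = ennreal (Gamma (1 - r / b) / r)" .
  have "(\<integral>\<^sup>+\<omega>. ennreal (X \<omega> powr r) \<partial>M) = ennreal (r / Gamma (1 - r)) * (ennreal (Gamma (1 - r) / r) * (\<integral>\<^sup>+\<omega>. ennreal (X \<omega> powr r) \<partial>M))"
    using G r by (simp add: mult.assoc[symmetric] flip: ennreal_mult')
  also have "\<dots> = ennreal (Gamma (1 - r / b) / Gamma (1 - r))"
    unfolding * using G r by (simp flip: ennreal_mult')
  finally have "(\<integral>\<^sup>+\<omega>. ennreal (X \<omega> powr r) \<partial>M) = ennreal (Gamma (1 - r / b) / Gamma (1 - r))" .
  then show ?thesis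
    using G by (subst integral_eq_nn_integral) auto
qed

lemma AE_lborel_interval:
  assumes "AE t in lborel. P t" and "a < (b::real)"
  shows "\<exists>t. a < t \<and> t < b \<and> P t"
proof (rule ccontr)
  assume *: "\<not> ?thesis"
  have "AE t in lborel. t \<notin> {a<..<b}"
    using assms(1) by eventually_elim (use * in auto)
  then have "{a<..<b} \<in> null_sets lborel"
    by (subst (asm) AE_iff_null_sets[symmetric]) auto
  then show False using assms(2) by (auto simp: null_sets_def)
qed

text \<open>The two sides agree almost everywhere, hence at points arbitrarily close to
  \<open>t\<close> on either side. If \<open>m t\<close> were larger, monotonicity would contradict
  agreement just to the right of \<open>t\<close>; if smaller, just to the left.\<close>

lemma laplace_powr_inverse:
  assumes m[measurable]: "m \<in> borel_measurable borel" and mono: "mono_on {0..} m"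
    and lap: "\<And>s. s > 0 \<Longrightarrow> laplace m s = ennreal (C / s powr a)"
    and a: "a > 0" and C: "C \<ge> 0" and t: "t > 0"
  shows "m t = ennreal (C * t powr (a - 1) / Gamma a)"
proof -
  define h where "h t = C * t powr (a - 1) / Gamma a" for t
  have G: "Gamma a > 0" using a by (rule Gamma_real_pos)
  have "laplace (\<lambda>t. ennreal (h t)) s = ennreal (C / s powr a)" if "s > 0" for s
  proof -
    have "laplace (\<lambda>t. ennreal (h t)) s = ennreal (C / Gamma a) * laplace (\<lambda>t. ennreal (t powr (a - 1))) s"
      unfolding laplace_def h_def
      by (subst nn_integral_cmult[symmetric]) (use C G in \<open>auto simp: indicator_def mult.assoc simp flip: ennreal_mult' intro!: nn_integral_cong\<close>)
    then show ?thesis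
      using that C G a by (simp add: laplace_powr flip: ennreal_mult')
  qed
  then have AE: "AE t in lborel. t > 0 \<longrightarrow> m t = ennreal (h t)"
    by (intro laplace_unique) (auto simp: lap h_def)
  have cont: "isCont (\<lambda>t. ennreal (h t)) t"
    unfolding h_def using t G by (intro continuous_intros isCont_ennreal) auto
  have "m t = ennreal (h t)"
  proof (rule antisym; rule ccontr)
    assume "\<not> m t \<le> ennreal (h t)"
    then have "\<forall>\<^sub>F x in at t. ennreal (h x) < m t"
      using cont by (intro order_tendstoD) (auto simp: isCont_def)
    then obtain d where d: "d > 0" "\<And>x. x \<noteq> t \<Longrightarrow> dist x t < d \<Longrightarrow> ennreal (h x) < m t"
      unfolding eventually_at by auto
    obtain x where x: "t < x" "x < t + d" "x > 0 \<longrightarrow> m x = ennreal (h x)"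
      using AE_lborel_interval[OF AE, of t "t + d"] d by auto
    have "m t \<le> m x" using x t by (intro mono_onD[OF mono]) auto
    then show False using d(2)[of x] x t by (auto simp: dist_real_def)
  next
    assume "\<not> ennreal (h t) \<le> m t"
    then have "\<forall>\<^sub>F x in at t. m t < ennreal (h x)"
      using cont by (intro order_tendstoD) (auto simp: isCont_def)
    then obtain d where d: "d > 0" "\<And>x. x \<noteq> t \<Longrightarrow> dist x t < d \<Longrightarrow> m t < ennreal (h x)"
      unfolding eventually_at by auto
    obtain x where x: "max 0 (t - d) < x" "x < t" "x > 0 \<longrightarrow> m x = ennreal (h x)"
      using AE_lborel_interval[OF AE, of "max 0 (t - d)" t] d t by auto
    have "m x \<le> m t" using x t by (intro mono_onD[OF mono]) auto
    then show False using d(2)[of x] x t by (auto simp: dist_real_def)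
  qed
  then show ?thesis by (simp add: h_def)
qed

subsection \<open>Caputo derivatives of Mittag-Leffler type series\<close>

lemma has_bochner_integral_Beta_scaled:
  fixes a b t :: real
  assumes a: "a > 0" and b: "b > 0" and t: "t > 0"
  shows "has_bochner_integral lborel (\<lambda>r. indicator {0<..<t} r * (r powr (a - 1) * (t - r) powr (b - 1)))
    (t powr (a + b - 1) * Beta a b)"
proof (rule has_bochner_integral_nn_integral)
  show "(\<integral>\<^sup>+r. ennreal (indicator {0<..<t} r * (r powr (a - 1) * (t - r) powr (b - 1))) \<partial>lborel)
    = ennreal (t powr (a + b - 1) * Beta a b)"
    unfolding nn_integral_Beta_scaled[OF assms, symmetric]
    by (intro nn_integral_cong) (auto simp: indicator_def)
  show "0 \<le> t powr (a + b - 1) * Beta a b"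
    using a b by (simp add: Beta_def Gamma_real_pos less_imp_le)
qed auto

text \<open>The beta integral turns the exponent \<open>\<alpha> j\<close> into
  \<open>\<alpha> j - \<beta> = \<alpha> (j - K)\<close>, with the matching Gamma factor. For
  \<open>j \<ge> K\<close> this is again a series of the same type; for \<open>1 \<le> j < K\<close>
  negative exponents remain. The geometric bound on \<open>d\<close> justifies the exchange of sum
  and integral.\<close>

lemma caputo_deriv_mittag_leffler_series:
  fixes d :: "nat \<Rightarrow> real" and \<alpha> \<beta> B t :: real
  assumes \<alpha>: "\<alpha> > 0" and \<beta>: "\<beta> < 1" and K: "\<beta> = \<alpha> * real K" "K > 0"
    and B: "\<And>j. \<bar>d j\<bar> \<le> B ^ j"
    and u: "\<And>t. t > 0 \<Longrightarrow> u t = (\<Sum>j. d j * t powr (\<alpha> * real j) / Gamma (1 + \<alpha> * real j))"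
    and t: "t > 0"
  shows "caputo_differentiable \<beta> u t"
    and "caputo_deriv \<beta> u t = (\<Sum>j. d (j + K) * t powr (\<alpha> * real j) / Gamma (1 + \<alpha> * real j))
      + (\<Sum>j = 1..K - 1. d j * t powr (\<alpha> * real j - \<beta>) / Gamma (1 + \<alpha> * real j - \<beta>))"
proof -
  define a where "a j = d j / Gamma (1 + \<alpha> * real j)" for j
  \<comment> \<open>Coefficients of the termwise derivative. The constant term disappears, so
    \<open>b j\<close> belongs to the original index \<open>Suc j\<close>.\<close>
  define b where "b j = \<alpha> * real (Suc j) * a (Suc j)" for j
  have Gpos: "Gamma (1 + \<alpha> * real j) > 0" for j
    using \<alpha> by (intro Gamma_real_pos add_pos_nonneg) auto
  have pw: "x powr (\<alpha> * real j) = (x powr \<alpha>) ^ j" if "x > 0" for x j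
    using that by (simp add: powr_powr[symmetric] powr_realpow)
  have B0: "B \<ge> 0" using B[of 1] by (simp add: order_trans[OF abs_ge_zero])
  have sm: "summable (\<lambda>j. \<bar>a j\<bar> * x ^ j)" for x
  proof (rule summable_comparison_test'[OF summable_mittag_leffler[OF \<alpha>, of "B * \<bar>x\<bar>"], of 0])
    fix j
    have "norm (\<bar>a j\<bar> * x ^ j) = \<bar>d j\<bar> * \<bar>x\<bar> ^ j / Gamma (1 + \<alpha> * real j)"
      using Gpos[of j] by (simp add: a_def abs_mult power_abs)
    also have "\<dots> \<le> (B * \<bar>x\<bar>) ^ j / Gamma (1 + \<alpha> * real j)"
      using Gpos[of j] B[of j] by (auto simp: power_mult_distrib intro!: divide_right_mono mult_right_mono)
    finally show "norm (\<bar>a j\<bar> * x ^ j) \<le> (B * \<bar>x\<bar>) ^ j / Gamma (1 + \<alpha> * real j)" .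
  qed
  have sma: "summable (\<lambda>j. a j * x ^ j)" for x
    by (rule summable_norm_cancel) (use sm[of "\<bar>x\<bar>"] in \<open>simp add: abs_mult power_abs\<close>)
  define F where "F x = (\<Sum>j. a j * x ^ j)" for x
  have uF: "u r = F (r powr \<alpha>)" if "r > 0" for r
    unfolding u[OF that] F_def pw[OF that] by (simp add: a_def)
  have diffs_b: "diffs a j * (r powr \<alpha>) ^ j * (\<alpha> * r powr (\<alpha> - 1)) = b j * r powr (\<alpha> * real (Suc j) - 1)"
    if "r > 0" for r j
  proof -
    have "r powr (\<alpha> * real (Suc j) - 1) = (r powr \<alpha>) ^ j * r powr (\<alpha> - 1)"
      unfolding pw[OF that, symmetric] powr_add[symmetric] by (simp add: algebra_simps)
    then show ?thesis by (simp add: diffs_def b_def algebra_simps)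
  qed
  have abs_b: "summable (\<lambda>j. \<bar>b j\<bar> * r powr (\<alpha> * real (Suc j) - 1))" if "r > 0" for r
  proof -
    have "summable (\<lambda>j. diffs (\<lambda>j. \<bar>a j\<bar>) j * (r powr \<alpha>) ^ j * (\<alpha> * r powr (\<alpha> - 1)))"
      by (intro summable_mult2 termdiff_converges_all sm)
    moreover have "diffs (\<lambda>j. \<bar>a j\<bar>) j * (r powr \<alpha>) ^ j * (\<alpha> * r powr (\<alpha> - 1)) = \<bar>b j\<bar> * r powr (\<alpha> * real (Suc j) - 1)" for j
    proof -
      have "diffs (\<lambda>j. \<bar>a j\<bar>) j * (r powr \<alpha>) ^ j * (\<alpha> * r powr (\<alpha> - 1))
        = \<bar>diffs a j * (r powr \<alpha>) ^ j * (\<alpha> * r powr (\<alpha> - 1))\<bar>"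
        using \<alpha> by (simp add: diffs_def abs_mult)
      then show ?thesis unfolding diffs_b[OF that] by (simp add: abs_mult)
    qed
    ultimately show ?thesis by simp
  qed
  \<comment> \<open>In the variable \<open>r powr \<alpha>\<close> the series is an everywhere
    convergent power series, so the chain rule gives the derivative at each positive
    \<open>r\<close>. Near 0 it may still blow up like \<open>r powr (\<alpha> - 1)\<close>.\<close>
  have du: "(u has_real_derivative (\<Sum>j. b j * r powr (\<alpha> * real (Suc j) - 1))) (at r)" if r: "r > 0" for r
  proof -
    have "(F has_real_derivative (\<Sum>j. diffs a j * (r powr \<alpha>) ^ j)) (at (r powr \<alpha>))"
      unfolding F_def by (rule termdiffs_strong_converges_everywhere) (rule sma)
    moreover have "((\<lambda>r. r powr \<alpha>) has_real_derivative (\<alpha> * r powr (\<alpha> - 1))) (at r)"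
      using r by (auto intro!: derivative_eq_intros)
    ultimately have "((\<lambda>r. F (r powr \<alpha>)) has_real_derivative
      (\<Sum>j. diffs a j * (r powr \<alpha>) ^ j) * (\<alpha> * r powr (\<alpha> - 1))) (at r)"
      by (rule DERIV_chain2)
    also have "(\<Sum>j. diffs a j * (r powr \<alpha>) ^ j) * (\<alpha> * r powr (\<alpha> - 1))
      = (\<Sum>j. diffs a j * (r powr \<alpha>) ^ j * (\<alpha> * r powr (\<alpha> - 1)))"
      by (intro suminf_mult2 termdiff_converges_all sma)
    also have "\<dots> = (\<Sum>j. b j * r powr (\<alpha> * real (Suc j) - 1))"
      using diffs_b[OF r] by simp
    finally show ?thesis
      by (rule DERIV_cong_ev[THEN iffD1, rotated -1, OF _ refl _ refl])
         (use r uF in \<open>auto intro!: eventually_mono[OF eventually_nhds_in_open[of "{0<..}" r]]\<close>)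
  qed
  \<comment> \<open>The terms of the Caputo integrand. Since
    \<open>\<alpha> * real (Suc j) > 0\<close> and \<open>1 - \<beta> > 0\<close>, the singularities
    at both endpoints are integrable.\<close>
  define g where "g j r = b j * (indicator {0<..<t} r * (r powr (\<alpha> * real (Suc j) - 1) * (t - r) powr ((1 - \<beta>) - 1)))" for j r
  define I where "I j = d (Suc j) * t powr (\<alpha> * real (Suc j) - \<beta>) / Gamma (1 + \<alpha> * real (Suc j) - \<beta>)" for j
  have g_eq: "g j r = indicator {0<..<t} r *\<^sub>R (b j * r powr (\<alpha> * real (Suc j) - 1) / (t - r) powr \<beta>)" for j r
    by (auto simp: g_def powr_minus divide_inverse indicator_def)
  have pos: "\<alpha> * real (Suc j) > 0" "1 + \<alpha> * real (Suc j) - \<beta> > 0" for j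
  proof -
    show *: "\<alpha> * real (Suc j) > 0" using \<alpha> by simp
    show "1 + \<alpha> * real (Suc j) - \<beta> > 0" using * \<beta> by linarith
  qed
  \<comment> \<open>The factor produced by differentiation and
    \<open>Gamma (1 + z) = z * Gamma z\<close> cancel; the \<open>Gamma (1 - \<beta>)\<close> left
    over is the normalisation of the Caputo derivative.\<close>
  have bBeta: "b j * (t powr (\<alpha> * real (Suc j) + (1 - \<beta>) - 1) * Beta (\<alpha> * real (Suc j)) (1 - \<beta>))
    = Gamma (1 - \<beta>) * I j" for j
  proof -
    have "Gamma (1 + \<alpha> * real (Suc j)) = \<alpha> * real (Suc j) * Gamma (\<alpha> * real (Suc j))"
      using pos(1)[of j] Gamma_plus1[of "\<alpha> * real (Suc j)"]
      by (auto simp: add.commute nonpos_Ints_def)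
    moreover have "Gamma (\<alpha> * real (Suc j)) > 0" using pos(1) by (intro Gamma_real_pos)
    moreover have "z * (x / (z * w)) * w = x" if "z > 0" "w > 0" for x z w :: real
      using that by simp
    ultimately have bG: "b j * Gamma (\<alpha> * real (Suc j)) = d (Suc j)"
      unfolding b_def a_def using pos(1)[of j] by presburger
    have e: "\<alpha> * real (Suc j) + (1 - \<beta>) = 1 + \<alpha> * real (Suc j) - \<beta>" by simp
    show ?thesis unfolding Beta_def I_def e bG[symmetric]
      by (simp add: mult_ac)
  qed
  have bg: "has_bochner_integral lborel (g j) (Gamma (1 - \<beta>) * I j)" for j
    unfolding bBeta[symmetric] g_def
    by (intro has_bochner_integral_mult_right has_bochner_integral_Beta_scaled) (use pos \<beta> t in auto)
  have nbg: "(\<integral>r. norm (g j r) \<partial>lborel) = Gamma (1 - \<beta>) * \<bar>I j\<bar>" for j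
  proof -
    have "(\<integral>r. norm (g j r) \<partial>lborel) = \<bar>b j\<bar> * (t powr (\<alpha> * real (Suc j) + (1 - \<beta>) - 1) * Beta (\<alpha> * real (Suc j)) (1 - \<beta>))"
    proof (rule has_bochner_integral_integral_eq)
      have "(\<lambda>r. norm (g j r)) = (\<lambda>r. \<bar>b j\<bar> * (indicator {0<..<t} r * (r powr (\<alpha> * real (Suc j) - 1) * (t - r) powr ((1 - \<beta>) - 1))))"
        by (auto simp: g_def abs_mult indicator_def)
      then show "has_bochner_integral lborel (\<lambda>r. norm (g j r)) (\<bar>b j\<bar> * (t powr (\<alpha> * real (Suc j) + (1 - \<beta>) - 1) * Beta (\<alpha> * real (Suc j)) (1 - \<beta>)))"
        by (elim ssubst) (intro has_bochner_integral_mult_right has_bochner_integral_Beta_scaled, use pos \<beta> t in auto)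
    qed
    also have "\<dots> = \<bar>b j * (t powr (\<alpha> * real (Suc j) + (1 - \<beta>) - 1) * Beta (\<alpha> * real (Suc j)) (1 - \<beta>))\<bar>"
      using pos(1)[of j] pos(2)[of j] \<beta> by (simp add: abs_mult Beta_def Gamma_real_pos add.commute algebra_simps)
    also have "\<dots> = Gamma (1 - \<beta>) * \<bar>I j\<bar>"
      unfolding bBeta using \<beta> by (simp add: abs_mult Gamma_real_pos)
    finally show ?thesis .
  qed
  \<comment> \<open>\<open>I\<close> starts at the original index 1, so original index
    \<open>K\<close> sits at position \<open>K - 1\<close>; from there on \<open>\<alpha> K\<close>
    absorbs \<open>\<beta>\<close> and the terms have Mittag-Leffler form.\<close>
  have IK: "I (j + (K - 1)) = d (j + K) * t powr (\<alpha> * real j) / Gamma (1 + \<alpha> * real j)" for j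
    using K by (simp add: I_def of_nat_diff algebra_simps)
  have smI: "summable (\<lambda>j. \<bar>I j\<bar>)"
  proof (subst summable_iff_shift[symmetric, of _ "K - 1"], unfold IK,
      rule summable_comparison_test'[OF summable_mult[OF summable_mittag_leffler[OF \<alpha>, of "B * t powr \<alpha>"]], of 0])
    fix j
    have "norm \<bar>d (j + K) * t powr (\<alpha> * real j) / Gamma (1 + \<alpha> * real j)\<bar>
      = \<bar>d (j + K)\<bar> * (t powr \<alpha>) ^ j / Gamma (1 + \<alpha> * real j)"
      using Gpos[of j] by (simp add: abs_mult pw[OF t])
    also have "\<dots> \<le> B ^ (j + K) * (t powr \<alpha>) ^ j / Gamma (1 + \<alpha> * real j)"
      using Gpos[of j] B[of "j + K"] by (intro divide_right_mono mult_right_mono) auto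
    also have "\<dots> = B ^ K * ((B * t powr \<alpha>) ^ j / Gamma (1 + \<alpha> * real j))"
      by (simp add: power_add power_mult_distrib)
    finally show "norm \<bar>d (j + K) * t powr (\<alpha> * real j) / Gamma (1 + \<alpha> * real j)\<bar>
      \<le> B ^ K * ((B * t powr \<alpha>) ^ j / Gamma (1 + \<alpha> * real j))" .
  qed
  have AEs: "AE r in lborel. summable (\<lambda>j. norm (g j r))"
  proof (rule AE_I2)
    fix r :: real
    show "summable (\<lambda>j. norm (g j r))"
    proof (cases "r \<in> {0<..<t}")
      case True
      then have "summable (\<lambda>j. \<bar>b j\<bar> * r powr (\<alpha> * real (Suc j) - 1) * (1 / (t - r) powr \<beta>))"
        by (intro summable_mult2 abs_b) auto
      then show ?thesis using True by (simp add: g_eq abs_mult)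
    qed (simp add: g_eq)
  qed
  have smg: "summable (\<lambda>j. \<integral>r. norm (g j r) \<partial>lborel)"
    unfolding nbg by (intro summable_mult smI)
  have du_eq: "indicator {0<..<t} r *\<^sub>R (deriv u r / (t - r) powr \<beta>) = (\<Sum>j. g j r)" for r
  proof (cases "r \<in> {0<..<t}")
    case True
    then have r: "r > 0" by simp
    have "deriv u r / (t - r) powr \<beta> = (\<Sum>j. b j * r powr (\<alpha> * real (Suc j) - 1) / (t - r) powr \<beta>)"
      unfolding DERIV_imp_deriv[OF du[OF r]]
      by (rule suminf_divide[symmetric], rule summable_norm_cancel)
         (use abs_b[OF r] in \<open>simp add: abs_mult\<close>)
    then show ?thesis using True by (simp add: g_eq)
  qed (simp add: g_eq)
  have intg: "integrable lborel (g j)" for j using bg by (rule integrable.intros)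
  show "caputo_differentiable \<beta> u t"
    unfolding caputo_differentiable_def set_integrable_def du_eq
    by (intro conjI ballI integrable_suminf intg AEs smg) (use du real_differentiable_def in \<open>metis greaterThanLessThan_iff\<close>)
  have "(LBINT r:{0<..<t}. deriv u r / (t - r) powr \<beta>) = (\<Sum>j. \<integral>r. g j r \<partial>lborel)"
    unfolding set_lebesgue_integral_def du_eq by (rule integral_suminf[OF intg AEs smg])
  also have "\<dots> = (\<Sum>j. Gamma (1 - \<beta>) * I j)"
    by (simp only: has_bochner_integral_integral_eq[OF bg])
  also have "\<dots> = Gamma (1 - \<beta>) * (\<Sum>j. I j)"
    by (rule suminf_mult) (use smI in \<open>rule summable_rabs_cancel\<close>)
  also have "(\<Sum>j. I j) = (\<Sum>j. I (j + (K - 1))) + sum I {..<K - 1}"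
    by (rule suminf_split_initial_segment) (use smI in \<open>rule summable_rabs_cancel\<close>)
  also have "sum I {..<K - 1} = (\<Sum>j = 1..K - 1. d j * t powr (\<alpha> * real j - \<beta>) / Gamma (1 + \<alpha> * real j - \<beta>))"
    by (simp add: I_def sum.atLeast1_atMost_eq)
  finally show "caputo_deriv \<beta> u t = (\<Sum>j. d (j + K) * t powr (\<alpha> * real j) / Gamma (1 + \<alpha> * real j))
      + (\<Sum>j = 1..K - 1. d j * t powr (\<alpha> * real j - \<beta>) / Gamma (1 + \<alpha> * real j - \<beta>))"
    unfolding caputo_deriv_def IK using less_imp_neq[OF Gamma_real_pos[of "1 - \<beta>"]] \<beta> by simp
qed

subsection \<open>The Poisson weights and the shift operator\<close>

lemma one_minus_shift_iter_cmult:
  "(one_minus_shift ^^ j) (\<lambda>i. a * f i) k = a * (one_minus_shift ^^ j) f k"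
proof (induction j arbitrary: k)
  case (Suc j)
  then show ?case
    by (simp add: one_minus_shift_def backward_shift_def algebra_simps)
qed simp

text \<open>The iterated operator combines finitely many entries linearly, so convergence for each
  \<open>k\<close> separately suffices.\<close>

lemma one_minus_shift_iter_sums:
  assumes "\<And>k. (\<lambda>j. f k j) sums S k"
  shows "(\<lambda>j. (one_minus_shift ^^ m) (\<lambda>k. f k j) k) sums (one_minus_shift ^^ m) S k"
proof (induction m arbitrary: k)
  case 0
  then show ?case using assms by simp
next
  case (Suc m)
  then show ?case
    by (auto simp: one_minus_shift_def backward_shift_def intro!: sums_diff)
qed

lemma one_minus_shift_iter_DERIV:
  assumes "\<And>k. (f k has_real_derivative f' k) (at z)"
  shows "((\<lambda>z. (one_minus_shift ^^ m) (\<lambda>k. f k z) k) has_real_derivative (one_minus_shift ^^ m) f' k) (at z)"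
proof (induction m arbitrary: k)
  case 0
  then show ?case using assms by simp
next
  case (Suc m)
  then show ?case
    by (auto simp: one_minus_shift_def backward_shift_def intro!: DERIV_diff)
qed

text \<open>The value at 0 of the j-th derivative of \<open>poisson_prob c k\<close>. The sign of
  \<open>j - k\<close> is written with \<open>j + k\<close> to avoid truncated subtraction, and the
  binomial coefficient vanishes for \<open>j < k\<close>.\<close>

definition poisson_coeff :: "real \<Rightarrow> nat \<Rightarrow> nat \<Rightarrow> real" where
  "poisson_coeff c k j = (- 1) ^ (j + k) * c ^ j * real (j choose k)"

text \<open>A binomial coefficient is at most its row sum \<open>2 ^ j\<close>. The geometric bound,
  uniform in \<open>k\<close>, is what both the expansion of the expectation and the Caputo lemma
  require.\<close>

lemma poisson_coeff_bound:
  assumes "c > 0"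
  shows "\<bar>poisson_coeff c k j\<bar> \<le> (2 * c) ^ j"
proof -
  have "j choose k \<le> 2 ^ j"
  proof (cases "k \<le> j")
    case True
    have "j choose k \<le> (\<Sum>i\<le>j. j choose i)"
      using True by (intro member_le_sum) auto
    then show ?thesis by (simp add: choose_row_sum)
  qed (simp add: binomial_eq_0)
  then have "real (j choose k) \<le> 2 ^ j"
    by (metis of_nat_le_iff of_nat_numeral of_nat_power)
  then show ?thesis
    using assms by (simp add: poisson_coeff_def abs_mult power_mult_distrib mult_right_mono mult.commute)
qed

text \<open>Pascal's rule, which is the forward equation of the Poisson weights read at time
  0.\<close>

lemma poisson_coeff_Suc:
  "poisson_coeff c k (Suc j) = - c * one_minus_shift (\<lambda>k. poisson_coeff c k j) k"
  by (cases k) (auto simp: poisson_coeff_def one_minus_shift_def backward_shift_def algebra_simps)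

text \<open>This converts the index shift made by the Caputo derivative into powers of the
  difference operator in \<open>k\<close>.\<close>

lemma poisson_coeff_add:
  "poisson_coeff c k (j + m) = (- c) ^ m * (one_minus_shift ^^ m) (\<lambda>k. poisson_coeff c k j) k"
proof (induction m arbitrary: k)
  case (Suc m)
  have "poisson_coeff c k (j + Suc m) = - c * one_minus_shift (\<lambda>k. poisson_coeff c k (j + m)) k"
    by (simp add: poisson_coeff_Suc)
  also have "\<dots> = - c * one_minus_shift (\<lambda>k. (- c) ^ m * (one_minus_shift ^^ m) (\<lambda>k. poisson_coeff c k j) k) k"
    by (simp add: Suc)
  also have "\<dots> = (- c) ^ Suc m * (one_minus_shift ^^ Suc m) (\<lambda>k. poisson_coeff c k j) k"
    by (simp add: one_minus_shift_iter_cmult[of 1, simplified])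
  finally show ?case .
qed simp

lemma poisson_prob_sums: "(\<lambda>j. poisson_coeff c k j * z ^ j / fact j) sums poisson_prob c k z"
proof -
  let ?f = "\<lambda>j. poisson_coeff c k j * z ^ j / fact j"
  have "(\<lambda>m. (- c * z) ^ m /\<^sub>R fact m) sums exp (- c * z)"
    by (rule exp_converges)
  then have "(\<lambda>m. (- c * z) ^ m /\<^sub>R fact m * ((c * z) ^ k / fact k)) sums (exp (- c * z) * ((c * z) ^ k / fact k))"
    by (rule sums_mult2)
  moreover have "?f (m + k) = (- c * z) ^ m /\<^sub>R fact m * ((c * z) ^ k / fact k)" for m
  proof -
    have "real (m + k choose k) / fact (m + k) = 1 / (fact m * fact k)"
      by (subst binomial_fact) auto
    moreover have "?f (m + k) = (- 1) ^ (m + k + k) * (c * z) ^ (m + k) * (real (m + k choose k) / fact (m + k))"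
      by (simp add: poisson_coeff_def power_mult_distrib)
    moreover have "(- 1 :: real) ^ (m + k + k) = (- 1) ^ m"
      by (simp add: power_add flip: power_mult_distrib)
    ultimately show ?thesis
      by (simp add: power_mult_distrib power_add divide_inverse power_minus[of "c * z"] mult_ac)
  qed
  ultimately have "(\<lambda>m. ?f (m + k)) sums poisson_prob c k z"
    by (simp add: poisson_prob_def)
  \<comment> \<open>The coefficients with index below \<open>k\<close> are zero, so the series may
    start at 0 instead of \<open>k\<close>.\<close>
  then show ?thesis
    by (subst (asm) sums_zero_iff_shift) (auto simp: poisson_coeff_def)
qed

lemma poisson_prob_0: "poisson_prob c k 0 = poisson_coeff c k 0"
  by (cases k) (auto simp: poisson_prob_def poisson_coeff_def)

lemma poisson_prob_DERIV:
  "(poisson_prob c k has_real_derivative (- c * one_minus_shift (\<lambda>k. poisson_prob c k z) k)) (at z)"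
proof (cases k)
  case 0
  then show ?thesis
    unfolding poisson_prob_def[abs_def]
    by (auto intro!: derivative_eq_intros simp: one_minus_shift_def backward_shift_def)
next
  case (Suc m)
  have *: "fact (Suc m) = (1 + real m) * fact m" by simp
  show ?thesis
    unfolding poisson_prob_def[abs_def] Suc
    by (rule derivative_eq_intros refl | simp)+
       (simp add: one_minus_shift_def backward_shift_def divide_simps, simp add: algebra_simps)
qed

lemma deriv_iter_poisson_prob: "(deriv ^^ j) (poisson_prob c k) 0 = poisson_coeff c k j"
proof -
  \<comment> \<open>The induction is over functions of \<open>z\<close>, since a value at 0 alone
    could not be differentiated again.\<close>
  have "(deriv ^^ j) (poisson_prob c k) = (\<lambda>z. (- c) ^ j * (one_minus_shift ^^ j) (\<lambda>k. poisson_prob c k z) k)"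
  proof (induction j)
    case (Suc j)
    show ?case
    proof
      fix z
      have "((\<lambda>z. (- c) ^ j * (one_minus_shift ^^ j) (\<lambda>k. poisson_prob c k z) k) has_real_derivative
        (- c) ^ j * (one_minus_shift ^^ j) (\<lambda>k. - c * one_minus_shift (\<lambda>k. poisson_prob c k z) k) k) (at z)"
        by (intro DERIV_cmult one_minus_shift_iter_DERIV poisson_prob_DERIV)
      then have "(deriv ^^ Suc j) (poisson_prob c k) z
        = (- c) ^ j * (one_minus_shift ^^ j) (\<lambda>k. - c * one_minus_shift (\<lambda>k. poisson_prob c k z) k) k"
        by (simp add: Suc DERIV_imp_deriv)
      also have "\<dots> = (- c) ^ Suc j * (one_minus_shift ^^ Suc j) (\<lambda>k. poisson_prob c k z) k"
        unfolding one_minus_shift_iter_cmult funpow_Suc_right by (simp add: comp_def)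
      finally show "(deriv ^^ Suc j) (poisson_prob c k) z = (- c) ^ Suc j * (one_minus_shift ^^ Suc j) (\<lambda>k. poisson_prob c k z) k" .
    qed
  qed simp
  then show ?thesis
    using poisson_coeff_add[of c k 0 j] by (simp add: poisson_prob_0)
qed

subsection \<open>Sample paths at random times\<close>

definition right_cont :: "(real \<Rightarrow> real) \<Rightarrow> bool" where
  "right_cont f \<longleftrightarrow> (\<forall>t\<ge>0. (f \<longlongrightarrow> f t) (at_right t))"

text \<open>\<open>inverse_process\<close> along a single path, so that its regularity can be proved
  without any measure.\<close>

definition right_inv :: "(real \<Rightarrow> real) \<Rightarrow> real \<Rightarrow> real" where
  "right_inv g t = Inf {s. 0 \<le> s \<and> t < g s}"

context
  fixes g :: "real \<Rightarrow> real"
  assumes mono: "mono_on {0..} g" and unb: "\<And>t. \<exists>s\<ge>0. t < g s" and rc: "right_cont g"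
begin

lemma right_inv_ne: "{s. 0 \<le> s \<and> t < g s} \<noteq> {}"
  using unb by auto

lemma right_inv_bdd: "bdd_below {s. 0 \<le> s \<and> t < g s}"
  by (rule bdd_belowI[of _ 0]) auto

lemma right_inv_nonneg: "0 \<le> right_inv g t"
  unfolding right_inv_def by (rule cInf_greatest[OF right_inv_ne]) auto

lemma right_inv_le: "0 \<le> s \<Longrightarrow> t < g s \<Longrightarrow> right_inv g t \<le> s"
  unfolding right_inv_def by (rule cInf_lower[OF _ right_inv_bdd]) auto

lemma right_inv_mono: "t \<le> t' \<Longrightarrow> right_inv g t \<le> right_inv g t'"
  unfolding right_inv_def
  by (rule cInf_superset_mono[OF right_inv_ne right_inv_bdd]) auto

text \<open>A witness \<open>s < a\<close> with \<open>t < g s\<close> bounds the inverse by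
  \<open>s\<close> on the whole interval up to \<open>g s\<close>; monotonicity gives the other
  half.\<close>

lemma right_cont_right_inv: "right_cont (right_inv g)"
  unfolding right_cont_def
proof (intro allI impI, rule order_tendstoI)
  fix t a :: real
  assume a: "a < right_inv g t"
  show "\<forall>\<^sub>F x in at_right t. a < right_inv g x"
    by (rule eventually_at_rightI[of t "t + 1"]) (use a right_inv_mono in \<open>auto intro: less_le_trans\<close>)
next
  fix t a :: real
  assume a: "right_inv g t < a"
  then obtain s where s: "0 \<le> s" "t < g s" "s < a"
    unfolding right_inv_def using cInf_less_iff[OF right_inv_ne right_inv_bdd] by auto
  show "\<forall>\<^sub>F x in at_right t. right_inv g x < a"
    by (rule eventually_at_rightI[of t "g s"]) (use s in \<open>auto intro: le_less_trans[OF right_inv_le]\<close>)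
qed

text \<open>Right continuity keeps \<open>g\<close> below \<open>t\<close> slightly beyond
  \<open>x\<close>, up to some \<open>y > x\<close>; that \<open>y\<close> bounds the infimum from
  below, and so the inequality is strict.\<close>

lemma less_right_invI:
  assumes x: "0 \<le> x" and lt: "g x < t"
  shows "x < right_inv g t"
proof -
  have "\<forall>\<^sub>F y in at_right x. g y < t"
    using rc x lt by (auto simp: right_cont_def intro: order_tendstoD)
  then obtain b where b: "b > x" "\<And>y. x < y \<Longrightarrow> y < b \<Longrightarrow> g y < t"
    using eventually_at_right[of x "x + 1"] by auto
  define y where "y = (x + b) / 2"
  have y: "x < y" "g y < t" using b by (auto simp: y_def)
  have "y \<le> right_inv g t"
    unfolding right_inv_def
  proof (rule cInf_greatest[OF right_inv_ne], safe)
    fix s assume s: "0 \<le> s" "t < g s"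
    show "y \<le> s"
    proof (rule ccontr)
      assume "\<not> y \<le> s"
      then have "g s \<le> g y" using s by (intro mono_onD[OF mono]) auto
      then show False using y s by simp
    qed
  qed
  then show ?thesis using y by simp
qed

end

text \<open>The approximation uses only times strictly to the right of \<open>y\<close> and makes evaluation at a
  random time jointly measurable; the value is \<open>p y\<close> for right continuous \<open>p\<close> and \<open>y \<ge> 0\<close>, and
  unspecified when the limit does not exist.\<close>

definition path_at :: "real \<Rightarrow> (real \<Rightarrow> real) \<Rightarrow> real" where
  "path_at y p = lim (\<lambda>m. p ((real (nat \<lfloor>y * real (Suc m)\<rfloor>) + 1) / real (Suc m)))"

text \<open>The sample times are the first multiples of \<open>1 / Suc m\<close> strictly beyond
  \<open>y\<close>; they lie within \<open>1 / Suc m\<close> of it and approach it from the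
  right.\<close>

lemma path_at_eq:
  assumes "right_cont p" "y \<ge> 0"
  shows "path_at y p = p y"
proof -
  let ?x = "\<lambda>m. (real (nat \<lfloor>y * real (Suc m)\<rfloor>) + 1) / real (Suc m)"
  have gt: "y < ?x m" and le: "?x m \<le> y + 1 / real (Suc m)" for m
  proof -
    have *: "real (nat \<lfloor>y * real (Suc m)\<rfloor>) = of_int \<lfloor>y * real (Suc m)\<rfloor>"
      using assms(2) by simp
    show "y < ?x m" unfolding * by (simp add: pos_less_divide_eq)
    have "?x m \<le> (y * real (Suc m) + 1) / real (Suc m)"
      unfolding * by (intro divide_right_mono add_right_mono of_int_floor_le) auto
    then show "?x m \<le> y + 1 / real (Suc m)" by (simp add: add_divide_distrib)
  qed
  have "?x \<longlonglongrightarrow> y"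
  proof (rule tendsto_sandwich[of "\<lambda>_. y" ?x _ "\<lambda>m. y + 1 / real (Suc m)"])
    show "(\<lambda>m. y + 1 / real (Suc m)) \<longlonglongrightarrow> y"
      using tendsto_add[OF tendsto_const LIMSEQ_inverse_real_of_nat] by (simp add: inverse_eq_divide)
    show "\<forall>\<^sub>F m in sequentially. y \<le> ?x m" using gt by (intro always_eventually allI less_imp_le)
    show "\<forall>\<^sub>F m in sequentially. ?x m \<le> y + 1 / real (Suc m)" using le by simp
  qed simp
  then have "filterlim ?x (at_right y) sequentially"
    unfolding filterlim_at
    by (intro conjI always_eventually allI) (use gt in \<open>simp, metis less_irrefl\<close>)
  then have "(\<lambda>m. p (?x m)) \<longlonglongrightarrow> p y"
    using assms by (auto simp: right_cont_def intro: filterlim_compose)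
  then show ?thesis unfolding path_at_def by (rule limI)
qed

abbreviation path_space :: "(real \<Rightarrow> real) measure" where
  "path_space \<equiv> \<Pi>\<^sub>M t\<in>{0..}. borel"

text \<open>For fixed \<open>m\<close> the coordinate that is read ranges over a countable grid, so
  each approximation is a countable gluing of coordinate maps.\<close>

lemma measurable_path_at [measurable]:
  "(\<lambda>(y, p). path_at y p) \<in> borel \<Otimes>\<^sub>M path_space \<rightarrow>\<^sub>M borel"
proof -
  have "(\<lambda>x. (\<lambda>i x. snd x ((real i + 1) / real (Suc m))) (nat \<lfloor>fst x * real (Suc m)\<rfloor>) x)
     \<in> (borel \<Otimes>\<^sub>M path_space) \<rightarrow>\<^sub>M borel" for m
  proof (rule measurable_compose_countable[where f = "\<lambda>i x. snd x ((real i + 1) / real (Suc m))"])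
    show "(\<lambda>x. snd x ((real i + 1) / real (Suc m))) \<in> (borel \<Otimes>\<^sub>M path_space) \<rightarrow>\<^sub>M borel" for i
      by (rule measurable_compose[OF measurable_snd measurable_component_singleton]) auto
  qed measurable
  then show ?thesis
    unfolding path_at_def split_beta' by (intro borel_measurable_lim_metric) simp
qed

lemma stable_subordinator_laplace:
  assumes "prob_space M" and X: "stable_subordinator M b X" and s: "s \<ge> 0" and x: "x \<ge> 0"
  shows "(\<integral>\<^sup>+\<omega>. ennreal (exp (- s * X x \<omega>)) \<partial>M) = ennreal (exp (- x * s powr b))"
proof -
  have *: "(\<integral>\<omega>. exp (- s * X x \<omega>) \<partial>M) = exp (- x * s powr b)"
    using X s x by (auto simp: stable_subordinator_def)
  \<comment> \<open>A function that is not integrable has Bochner integral 0, whereas the value here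
    is an exponential.\<close>
  then have "integrable M (\<lambda>\<omega>. exp (- s * X x \<omega>))"
    by (metis exp_not_eq_zero not_integrable_integral_eq)
  then show ?thesis
    using * by (subst nn_integral_eq_integral) auto
qed

lemma stable_subordinator_measurable:
  assumes "stable_subordinator M b X" "x \<ge> 0"
  shows "X x \<in> borel_measurable M"
  using assms by (auto simp: stable_subordinator_def subordinator_def levy_process_def)

definition subordinator_path :: "(real \<Rightarrow> real) \<Rightarrow> bool" where
  "subordinator_path g \<longleftrightarrow> mono_on {0..} g \<and> (\<forall>t. \<exists>s\<ge>0. t < g s) \<and> right_cont g \<and> g 0 = 0"

text \<open>Unboundedness is not part of the definition of a subordinator. The means of
  \<open>exp (- X m)\<close> are \<open>exp (- m)\<close>, hence summable, so
  \<open>exp (- X m)\<close> tends to 0 almost surely. It keeps the infimum in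
  \<open>inverse_process\<close> off the empty set.\<close>

lemma stable_subordinator_paths:
  assumes "prob_space M" and X: "stable_subordinator M b X"
  shows "AE \<omega> in M. subordinator_path (\<lambda>t. X t \<omega>)"
proof -
  interpret prob_space M by fact
  have [measurable]: "X (real m) \<in> borel_measurable M" for m
    using X by (rule stable_subordinator_measurable) simp
  have "(\<integral>\<^sup>+\<omega>. (\<Sum>m. ennreal (exp (- X (real m) \<omega>))) \<partial>M) = (\<Sum>m. \<integral>\<^sup>+\<omega>. ennreal (exp (- X (real m) \<omega>)) \<partial>M)"
    by (rule nn_integral_suminf) simp
  also have "\<dots> = (\<Sum>m. ennreal (exp (- 1) ^ m))"
    using stable_subordinator_laplace[OF assms, of 1] by (simp add: exp_of_nat_mult[symmetric])
  also have "\<dots> = ennreal (\<Sum>m. exp (- 1) ^ m)"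
    by (rule suminf_ennreal2) (auto intro!: summable_geometric)
  finally have "AE \<omega> in M. (\<Sum>m. ennreal (exp (- X (real m) \<omega>))) \<noteq> \<infinity>"
    by (intro nn_integral_PInf_AE) auto
  then have unb: "AE \<omega> in M. \<forall>t. \<exists>s\<ge>0. t < X s \<omega>"
  proof eventually_elim
    case (elim \<omega>)
    then have "summable (\<lambda>m. exp (- X (real m) \<omega>))"
      by (intro summable_suminf_not_top) auto
    then have lim: "(\<lambda>m. exp (- X (real m) \<omega>)) \<longlonglongrightarrow> 0" by (rule summable_LIMSEQ_zero)
    show ?case
    proof
      fix t
      have "\<forall>\<^sub>F m in sequentially. exp (- X (real m) \<omega>) < exp (- t)"
        using lim by (rule order_tendstoD) simp
      then obtain m where "exp (- X (real m) \<omega>) < exp (- t)"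
        by (auto simp: eventually_sequentially)
      then show "\<exists>s\<ge>0. t < X s \<omega>" by (intro exI[of _ "real m"]) auto
    qed
  qed
  have "AE \<omega> in M. cadlag (\<lambda>t. X t \<omega>)" "AE \<omega> in M. X 0 \<omega> = 0" "AE \<omega> in M. mono_on {0..} (\<lambda>t. X t \<omega>)"
    using X by (auto simp: stable_subordinator_def subordinator_def levy_process_def)
  with unb show ?thesis
    by eventually_elim (auto simp: subordinator_path_def right_cont_def cadlag_def)
qed

text \<open>The restriction to \<open>{0..}\<close> makes this the random element that occurs in
  \<open>independent_processes\<close>.\<close>

definition sample_path :: "(real \<Rightarrow> 'a \<Rightarrow> real) \<Rightarrow> 'a \<Rightarrow> real \<Rightarrow> real" where
  "sample_path X \<omega> = (\<lambda>t\<in>{0..}. X t \<omega>)"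

lemma path_at_path: "path_at y (sample_path X \<omega>) = path_at y (\<lambda>t. X t \<omega>)"
  by (simp add: sample_path_def path_at_def)

text \<open>The kernel that averages \<open>\<phi>\<close> over the state of \<open>X\<close> at a
  fixed time \<open>y\<close>. Going through \<open>path_at\<close> makes it Borel in
  \<open>y\<close>.\<close>

definition path_mean :: "'a measure \<Rightarrow> (real \<Rightarrow> 'a \<Rightarrow> real) \<Rightarrow> (real \<Rightarrow> ennreal) \<Rightarrow> real \<Rightarrow> ennreal" where
  "path_mean P X \<phi> y = (\<integral>\<^sup>+\<omega>. \<phi> (path_at y (sample_path X \<omega>)) \<partial>P)"

lemma path_mean_eq:
  assumes "AE \<omega> in P. right_cont (\<lambda>t. X t \<omega>)" "y \<ge> 0"
  shows "path_mean P X \<phi> y = (\<integral>\<^sup>+\<omega>. \<phi> (X y \<omega>) \<partial>P)"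
  unfolding path_mean_def path_at_path
  by (rule nn_integral_cong_AE) (use assms in \<open>auto simp: path_at_eq elim!: eventually_mono\<close>)

lemma measurable_path_at_path:
  assumes [measurable]: "sample_path X \<in> P \<rightarrow>\<^sub>M path_space"
  shows "(\<lambda>x. path_at (fst x) (sample_path X (snd x))) \<in> borel \<Otimes>\<^sub>M P \<rightarrow>\<^sub>M borel"
  using measurable_compose[OF _ measurable_path_at, of "\<lambda>x. (fst x, sample_path X (snd x))"]
  by (simp add: split_beta')

lemma borel_measurable_path_mean:
  assumes "prob_space P" and X: "sample_path X \<in> P \<rightarrow>\<^sub>M path_space" and \<phi>[measurable]: "\<phi> \<in> borel_measurable borel"
  shows "path_mean P X \<phi> \<in> borel_measurable borel"
proof -
  interpret prob_space P by fact
  have [measurable]: "(\<lambda>(y, \<omega>). path_at y (sample_path X \<omega>)) \<in> borel \<Otimes>\<^sub>M P \<rightarrow>\<^sub>M borel"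
    using measurable_path_at_path[OF X] by (simp add: split_beta')
  show ?thesis
    unfolding path_mean_def[abs_def] by measurable
qed

text \<open>Conditioning on an independent random time: independence enters as the product form of
  the joint law, and Fubini integrates out the path first.\<close>

lemma nn_integral_random_time:
  assumes "prob_space P" and Ym[measurable]: "Y \<in> borel_measurable P"
    and Xm[measurable]: "sample_path X \<in> P \<rightarrow>\<^sub>M path_space"
    and eq: "distr P borel Y \<Otimes>\<^sub>M distr P path_space (sample_path X) = distr P (borel \<Otimes>\<^sub>M path_space) (\<lambda>\<omega>. (Y \<omega>, sample_path X \<omega>))"
    and \<phi>[measurable]: "\<phi> \<in> borel_measurable borel"
  shows "(\<integral>\<^sup>+\<omega>. \<phi> (path_at (Y \<omega>) (sample_path X \<omega>)) \<partial>P) = (\<integral>\<^sup>+\<omega>. path_mean P X \<phi> (Y \<omega>) \<partial>P)"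
proof -
  interpret prob_space P by fact
  interpret D: prob_space "distr P path_space (sample_path X)"
    by (rule prob_space_distr) simp
  have pm: "(\<lambda>(y, p). \<phi> (path_at y p)) \<in> borel_measurable (borel \<Otimes>\<^sub>M path_space)"
    using measurable_compose[OF measurable_path_at \<phi>] by (simp add: split_beta')
  have "(\<integral>\<^sup>+\<omega>. \<phi> (path_at (Y \<omega>) (sample_path X \<omega>)) \<partial>P) = (\<integral>\<^sup>+\<omega>. (\<lambda>(y, p). \<phi> (path_at y p)) (Y \<omega>, sample_path X \<omega>) \<partial>P)"
    by simp
  also have "\<dots> = (\<integral>\<^sup>+x. (\<lambda>(y, p). \<phi> (path_at y p)) x \<partial>distr P (borel \<Otimes>\<^sub>M path_space) (\<lambda>\<omega>. (Y \<omega>, sample_path X \<omega>)))"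
    by (rule nn_integral_distr[symmetric]) (use pm in auto)
  also have "\<dots> = (\<integral>\<^sup>+x. (\<lambda>(y, p). \<phi> (path_at y p)) x \<partial>(distr P borel Y \<Otimes>\<^sub>M distr P path_space (sample_path X)))"
    unfolding eq ..
  also have "\<dots> = (\<integral>\<^sup>+y. \<integral>\<^sup>+p. \<phi> (path_at y p) \<partial>distr P path_space (sample_path X) \<partial>distr P borel Y)"
    by (subst D.nn_integral_fst[symmetric]) (use pm in auto)
  also have "\<dots> = (\<integral>\<^sup>+y. path_mean P X \<phi> y \<partial>distr P borel Y)"
    unfolding path_mean_def
    by (intro nn_integral_cong nn_integral_distr) (use measurable_compose[OF _ pm] in auto)
  also have "\<dots> = (\<integral>\<^sup>+\<omega>. path_mean P X \<phi> (Y \<omega>) \<partial>P)"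
    by (rule nn_integral_distr) (use borel_measurable_path_mean[OF assms(1) Xm \<phi>] in auto)
  finally show ?thesis .
qed

subsection \<open>Inverse stable subordinators\<close>

lemma laplace_mono: "(\<And>t. t > 0 \<Longrightarrow> f t \<le> g t) \<Longrightarrow> laplace f s \<le> laplace g s"
  unfolding laplace_def by (intro nn_integral_mono) (auto simp: indicator_def mult_right_mono)

lemma laplace_cong: "(\<And>t. t > 0 \<Longrightarrow> f t = g t) \<Longrightarrow> laplace f s = laplace g s"
  by (intro antisym laplace_mono) auto

text \<open>The relation \<open>r\<close> covers \<open><\<close> and \<open>\<le>\<close> at once:
  they differ only at \<open>t = X\<close>, a Lebesgue null set of times, so atoms of the law of
  \<open>X\<close> do not affect the transform.\<close>

lemma laplace_distribution:
  assumes "prob_space M" and X[measurable]: "X \<in> borel_measurable M" and nonneg: "AE \<omega> in M. 0 \<le> X \<omega>"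
    and s: "s > 0" and r[measurable]: "Measurable.pred (borel \<Otimes>\<^sub>M borel) (\<lambda>(x, t). r x t)"
    and r1: "\<And>x t. x < t \<Longrightarrow> r x t" and r2: "\<And>x t. r x t \<Longrightarrow> x \<le> (t::real)"
  shows "laplace (\<lambda>t. \<integral>\<^sup>+\<omega>. (if r (X \<omega>) t then 1 else 0) \<partial>M) s = (\<integral>\<^sup>+\<omega>. ennreal (exp (- s * X \<omega>)) \<partial>M) / ennreal s"
proof -
  interpret prob_space M by fact
  interpret pair_sigma_finite M lborel ..
  have r'[measurable (raw)]: "Measurable.pred N (\<lambda>x. r (f x) (g x))"
    if [measurable]: "f \<in> borel_measurable N" "g \<in> borel_measurable N" for f g N
    using measurable_compose[OF _ r, of "\<lambda>x. (f x, g x)"] by simp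
  have "laplace (\<lambda>t. \<integral>\<^sup>+\<omega>. (if r (X \<omega>) t then 1 else 0) \<partial>M) s
    = (\<integral>\<^sup>+t. \<integral>\<^sup>+\<omega>. (if r (X \<omega>) t then 1 else 0) * (ennreal (exp (- s * t)) * indicator {0<..} t) \<partial>M \<partial>lborel)"
    unfolding laplace_def by (subst nn_integral_multc) (auto simp: mult.assoc)
  also have "\<dots> = (\<integral>\<^sup>+\<omega>. \<integral>\<^sup>+t. (if r (X \<omega>) t then 1 else 0) * (ennreal (exp (- s * t)) * indicator {0<..} t) \<partial>lborel \<partial>M)"
    by (rule Fubini') (simp add: split_beta')
  also have "\<dots> = (\<integral>\<^sup>+\<omega>. ennreal (exp (- s * X \<omega>)) / ennreal s \<partial>M)"
  proof (rule nn_integral_cong_AE, use nonneg in eventually_elim)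
    fix \<omega> assume X0: "0 \<le> X \<omega>"
    have "(\<integral>\<^sup>+t. (if r (X \<omega>) t then 1 else 0) * (ennreal (exp (- s * t)) * indicator {0<..} t) \<partial>lborel)
      = (\<integral>\<^sup>+t. ennreal (exp (- s * t)) * indicator {X \<omega>..} t \<partial>lborel)"
    proof (rule nn_integral_cong_AE, use AE_lborel_singleton[of "X \<omega>"] in eventually_elim)
      fix t assume "t \<noteq> X \<omega>"
      then consider "t < X \<omega>" | "X \<omega> < t" by linarith
      then show "(if r (X \<omega>) t then 1 else 0) * (ennreal (exp (- s * t)) * indicator {0<..} t)
        = ennreal (exp (- s * t)) * indicator {X \<omega>..} t"
      proof cases
        case 1
        then show ?thesis using r2[of "X \<omega>" t] by auto
      next
        case 2
        then show ?thesis using r1[of "X \<omega>" t] X0 by auto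
      qed
    qed
    then show "(\<integral>\<^sup>+t. (if r (X \<omega>) t then 1 else 0) * (ennreal (exp (- s * t)) * indicator {0<..} t) \<partial>lborel)
      = ennreal (exp (- s * X \<omega>)) / ennreal s"
      using nn_integral_exp_atLeast[OF s, of "X \<omega>"] s by (simp add: divide_ennreal)
  qed
  also have "\<dots> = (\<integral>\<^sup>+\<omega>. ennreal (exp (- s * X \<omega>)) \<partial>M) / ennreal s"
    by (rule nn_integral_divide) simp
  finally show ?thesis .
qed

text \<open>The fourth and fifth facts enclose \<open>x < inverse_process G t\<close> between
  \<open>G x < t\<close> and \<open>G x \<le> t\<close>; the converse implications can fail where
  \<open>G\<close> jumps or is flat.\<close>

lemma inverse_process_path:
  assumes "subordinator_path (\<lambda>t. G t \<omega>)"
  shows "right_cont (\<lambda>t. inverse_process G t \<omega>)"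
    and "inverse_process G t \<omega> \<ge> 0"
    and "t \<le> t' \<Longrightarrow> inverse_process G t \<omega> \<le> inverse_process G t' \<omega>"
    and "x \<ge> 0 \<Longrightarrow> G x \<omega> < t \<Longrightarrow> x < inverse_process G t \<omega>"
    and "x \<ge> 0 \<Longrightarrow> x < inverse_process G t \<omega> \<Longrightarrow> G x \<omega> \<le> t"
    and "x \<ge> 0 \<Longrightarrow> G x \<omega> \<ge> 0"
proof -
  have *: "inverse_process G t \<omega> = right_inv (\<lambda>t. G t \<omega>) t" for t
    by (simp add: inverse_process_def right_inv_def)
  have g: "mono_on {0..} (\<lambda>t. G t \<omega>)" "\<And>t. \<exists>s\<ge>0. t < G s \<omega>" "right_cont (\<lambda>t. G t \<omega>)" "G 0 \<omega> = 0"
    using assms by (auto simp: subordinator_path_def)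
  show "right_cont (\<lambda>t. inverse_process G t \<omega>)"
    unfolding * using right_cont_right_inv[OF g(1-3)] by simp
  show "inverse_process G t \<omega> \<ge> 0"
    unfolding * by (rule right_inv_nonneg[OF g(1-3)])
  show "inverse_process G t \<omega> \<le> inverse_process G t' \<omega>" if "t \<le> t'"
    unfolding * by (rule right_inv_mono[OF g(1-3) that])
  show "x < inverse_process G t \<omega>" if "x \<ge> 0" "G x \<omega> < t"
    unfolding * by (rule less_right_invI[OF g(1-3)]) (use that in auto)
  show "G x \<omega> \<le> t" if "x \<ge> 0" "x < inverse_process G t \<omega>"
    using that right_inv_le[OF g(1-3), of x t] unfolding * by (meson not_le)
  show "G x \<omega> \<ge> 0" if "x \<ge> 0"
    using mono_onD[OF g(1), of 0 x] g(4) that by simp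
qed

text \<open>For \<open>x \<ge> 0\<close> the lower and upper bounds for the tail have the same
  Laplace transform in \<open>t\<close>. For negative \<open>x\<close> the tail is 1 because the
  inverse is nonnegative, which \<open>max x 0\<close> records.\<close>

lemma laplace_path_mean_inverse_tail:
  assumes "prob_space M" and G: "stable_subordinator M b G" and s: "s > 0"
  shows "laplace (path_mean (completion M) (inverse_process G) (indicator {x<..})) s
    = ennreal (exp (- max x 0 * s powr b) / s)"
proof -
  note paths = stable_subordinator_paths[OF assms(1) G]
  interpret prob_space M by fact
  have H: "AE \<omega> in completion M. right_cont (\<lambda>t. inverse_process G t \<omega>)"
    using AE_completion[OF paths] by eventually_elim (rule inverse_process_path)
  have path_mean: "path_mean (completion M) (inverse_process G) (indicator {x<..}) t
    = (\<integral>\<^sup>+\<omega>. indicator {x<..} (inverse_process G t \<omega>) \<partial>M)" if "t > 0" for t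
    using that H by (simp add: path_mean_eq nn_integral_completion)
  show ?thesis
  proof (cases "x \<ge> 0")
    case False
    have "laplace (path_mean (completion M) (inverse_process G) (indicator {x<..})) s = laplace (\<lambda>t. ennreal (t powr (1 - 1))) s"
    proof (rule laplace_cong)
      fix t :: real assume t: "t > 0"
      have "(\<integral>\<^sup>+\<omega>. indicator {x<..} (inverse_process G t \<omega>) \<partial>M) = (\<integral>\<^sup>+\<omega>. 1 \<partial>M)"
      proof (rule nn_integral_cong_AE, use paths in eventually_elim)
        case (elim \<omega>)
        then show ?case
          using inverse_process_path(2)[of G \<omega> t] False by simp
      qed
      then show "path_mean (completion M) (inverse_process G) (indicator {x<..}) t = ennreal (t powr (1 - 1))"
        using t by (simp add: path_mean emeasure_space_1)
    qed
    also have "\<dots> = ennreal (1 / s)"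
      using laplace_powr[of 1 s] s by simp
    finally show ?thesis using False by simp
  next
    case True
    note [measurable] = stable_subordinator_measurable[OF G True]
    have nonneg: "AE \<omega> in M. 0 \<le> G x \<omega>"
      using paths by eventually_elim (rule inverse_process_path(6)[OF _ True])
    have val: "(\<integral>\<^sup>+\<omega>. ennreal (exp (- s * G x \<omega>)) \<partial>M) / ennreal s = ennreal (exp (- max x 0 * s powr b) / s)"
      using True s by (subst stable_subordinator_laplace[OF assms(1) G]) (auto simp: divide_ennreal)
    show ?thesis
    proof (rule antisym)
      have "laplace (path_mean (completion M) (inverse_process G) (indicator {x<..})) s
        \<le> laplace (\<lambda>t. \<integral>\<^sup>+\<omega>. (if G x \<omega> \<le> t then 1 else 0) \<partial>M) s"
      proof (rule laplace_mono, unfold path_mean, rule nn_integral_mono_AE, use paths in eventually_elim)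
        fix t \<omega> assume "subordinator_path (\<lambda>t. G t \<omega>)"
        from inverse_process_path(5)[where G = G and \<omega> = \<omega> and x = x and t = t, OF this True]
        show "indicator {x<..} (inverse_process G t \<omega>) \<le> (if G x \<omega> \<le> t then 1 else 0 :: ennreal)"
          by (auto simp: indicator_def)
      qed
      also have "\<dots> = ennreal (exp (- max x 0 * s powr b) / s)"
        by (subst laplace_distribution[where r = "(\<le>)"]) (use assms nonneg val in auto)
      finally show "laplace (path_mean (completion M) (inverse_process G) (indicator {x<..})) s \<le> ennreal (exp (- max x 0 * s powr b) / s)" .
    next
      have "ennreal (exp (- max x 0 * s powr b) / s) = laplace (\<lambda>t. \<integral>\<^sup>+\<omega>. (if G x \<omega> < t then 1 else 0) \<partial>M) s"
        by (subst laplace_distribution[where r = "(<)"]) (use assms nonneg val in auto)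
      also have "\<dots> \<le> laplace (path_mean (completion M) (inverse_process G) (indicator {x<..})) s"
      proof (rule laplace_mono, unfold path_mean, rule nn_integral_mono_AE, use paths in eventually_elim)
        fix t \<omega> assume "subordinator_path (\<lambda>t. G t \<omega>)"
        from inverse_process_path(4)[where G = G and \<omega> = \<omega> and x = x and t = t, OF this True]
        show "(if G x \<omega> < t then 1 else 0 :: ennreal) \<le> indicator {x<..} (inverse_process G t \<omega>)"
          by (auto simp: indicator_def)
      qed
      finally show "ennreal (exp (- max x 0 * s powr b) / s) \<le> laplace (path_mean (completion M) (inverse_process G) (indicator {x<..})) s" .
    qed
  qed
qed

text \<open>Both sides integrate \<open>\<phi>\<close> against a finite measure on the line, and the
  preceding tail formula shows that the two measures coincide. Arbitrary Borel \<open>\<phi>\<close>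
  then come for free.\<close>

lemma laplace_path_mean_inverse:
  assumes "prob_space M" and G: "stable_subordinator M b G"
    and H[measurable]: "sample_path (inverse_process G) \<in> completion M \<rightarrow>\<^sub>M path_space"
    and s: "s > 0" and \<phi>: "\<phi> \<in> borel_measurable borel"
  shows "laplace (path_mean (completion M) (inverse_process G) \<phi>) s = ennreal (s powr (b - 1)) * laplace \<phi> (s powr b)"
proof -
  interpret prob_space M by fact
  interpret P: prob_space "completion M" by (rule prob_space_completion)
  define w where "w t = ennreal (exp (- s * t)) * indicator {0<..} t" for t :: real
  have [measurable]: "w \<in> borel_measurable borel" unfolding w_def by measurable
  \<comment> \<open>The distribution, of total mass \<open>1 / s\<close>, of the inverse sampled at
    an independent time with unnormalised exponential density.\<close>
  define \<nu> where "\<nu> = distr (density lborel w \<Otimes>\<^sub>M completion M) borel (\<lambda>x. path_at (fst x) (sample_path (inverse_process G) (snd x)))"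
  define \<mu> where "\<mu> = density lborel (\<lambda>x::real. ennreal (s powr (b - 1)) * (ennreal (exp (- (s powr b) * x)) * indicator {0<..} x))"
  have pm: "(\<lambda>x. path_at (fst x) (sample_path (inverse_process G) (snd x))) \<in> density lborel w \<Otimes>\<^sub>M completion M \<rightarrow>\<^sub>M borel"
    using measurable_path_at_path[OF H] by (simp cong: measurable_cong_sets)
  have \<nu>: "(\<integral>\<^sup>+x. f x \<partial>\<nu>) = laplace (path_mean (completion M) (inverse_process G) f) s" if [measurable]: "f \<in> borel_measurable borel" for f
  proof -
    have "(\<integral>\<^sup>+x. f x \<partial>\<nu>) = (\<integral>\<^sup>+x. f (path_at (fst x) (sample_path (inverse_process G) (snd x))) \<partial>(density lborel w \<Otimes>\<^sub>M completion M))"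
      unfolding \<nu>_def by (rule nn_integral_distr[OF pm]) simp
    also have "\<dots> = (\<integral>\<^sup>+t. \<integral>\<^sup>+\<omega>. f (path_at t (sample_path (inverse_process G) \<omega>)) \<partial>completion M \<partial>density lborel w)"
      by (subst P.nn_integral_fst[symmetric]) (use measurable_compose[OF pm that] in auto)
    also have "\<dots> = (\<integral>\<^sup>+t. path_mean (completion M) (inverse_process G) f t \<partial>density lborel w)"
      by (simp only: path_mean_def)
    also have "\<dots> = laplace (path_mean (completion M) (inverse_process G) f) s"
      using borel_measurable_path_mean[OF P.prob_space_axioms H that]
      by (subst nn_integral_density) (auto simp: laplace_def w_def mult_ac)
    finally show ?thesis .
  qed
  have \<mu>: "(\<integral>\<^sup>+x. f x \<partial>\<mu>) = ennreal (s powr (b - 1)) * laplace f (s powr b)" if [measurable]: "f \<in> borel_measurable borel" for f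
    unfolding \<mu>_def laplace_def
    by (subst nn_integral_density, simp, simp, subst nn_integral_cmult[symmetric]) (auto simp: mult_ac)
  have tail: "emeasure \<mu> {x<..} = ennreal (exp (- max x 0 * s powr b) / s)" for x
  proof -
    have sb: "s powr b > 0" using s by simp
    have "emeasure \<mu> {x<..} = (\<integral>\<^sup>+y. indicator {x<..} y \<partial>\<mu>)"
      by (simp add: \<mu>_def)
    also have "\<dots> = ennreal (s powr (b - 1)) * laplace (indicator {x<..}) (s powr b)"
      by (rule \<mu>) simp
    also have "laplace (indicator {x<..}) (s powr b) = (\<integral>\<^sup>+y. ennreal (exp (- (s powr b) * y)) * indicator {max x 0..} y \<partial>lborel)"
      unfolding laplace_def
      by (rule nn_integral_cong_AE, use AE_lborel_singleton[of "max x 0"] in eventually_elim)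
         (auto simp: indicator_def max_def split: if_splits)
    also have "\<dots> = ennreal (exp (- (s powr b) * max x 0) / s powr b)"
      by (rule nn_integral_exp_atLeast[OF sb])
    also have "ennreal (s powr (b - 1)) * \<dots> = ennreal (exp (- max x 0 * s powr b) / s)"
      using s by (simp add: powr_diff mult.commute flip: ennreal_mult')
    finally show ?thesis .
  qed
  have "\<nu> = \<mu>"
  proof (rule measure_eqI_lessThan)
    fix x :: real
    have "emeasure \<nu> {x<..} = (\<integral>\<^sup>+y. indicator {x<..} y \<partial>\<nu>)"
      by (simp add: \<nu>_def)
    also have "\<dots> = ennreal (exp (- max x 0 * s powr b) / s)"
      by (subst \<nu>) (auto simp: laplace_path_mean_inverse_tail[OF assms(1) G s])
    finally show eq: "emeasure \<nu> {x<..} = emeasure \<mu> {x<..}" "emeasure \<nu> {x<..} < \<infinity>"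
      by (auto simp: tail)
  qed (auto simp: \<nu>_def \<mu>_def)
  then show ?thesis using \<nu>[OF \<phi>] \<mu>[OF \<phi>] by simp
qed

text \<open>Inverse paths increase in time. This is the source of the monotonicity demanded by
  \<open>laplace_powr_inverse\<close>.\<close>

lemma path_mean_inverse_mono:
  assumes "prob_space M" and G: "stable_subordinator M b G" and \<phi>: "mono_on {0..} \<phi>"
  shows "mono_on {0..} (path_mean (completion M) (inverse_process G) \<phi>)"
proof (rule mono_onI)
  fix t t' :: real assume t: "t \<in> {0..}" "t' \<in> {0..}" "t \<le> t'"
  note paths = AE_completion[OF stable_subordinator_paths[OF assms(1) G]]
  have H: "AE \<omega> in completion M. right_cont (\<lambda>t. inverse_process G t \<omega>)"
    using paths by eventually_elim (rule inverse_process_path)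
  show "path_mean (completion M) (inverse_process G) \<phi> t \<le> path_mean (completion M) (inverse_process G) \<phi> t'"
    using t
    by (simp only: path_mean_eq[OF H] atLeast_iff, intro nn_integral_mono_AE, use paths in eventually_elim)
       (auto intro!: mono_onD[OF \<phi>] inverse_process_path)
qed

subsection \<open>Compositions of independent processes\<close>

text \<open>Any function of the block \<open>J\<close> is independent of the variable at
  \<open>i\<close>; the result has the product form that \<open>nn_integral_random_time\<close>
  consumes.\<close>

lemma (in prob_space) indep_vars_pair_law:
  assumes ind: "indep_vars (\<lambda>_. N) Z I" and J: "J \<subseteq> I" "i \<in> I" "i \<notin> J"
    and f[measurable]: "f \<in> (\<Pi>\<^sub>M j\<in>J. N) \<rightarrow>\<^sub>M L"
  shows "distr M L (\<lambda>\<omega>. f (\<lambda>j\<in>J. Z j \<omega>)) \<Otimes>\<^sub>M distr M N (Z i)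
    = distr M (L \<Otimes>\<^sub>M N) (\<lambda>\<omega>. (f (\<lambda>j\<in>J. Z j \<omega>), Z i \<omega>))"
proof -
  let ?A = "\<lambda>\<omega>. \<lambda>j\<in>J. Z j \<omega>" and ?B = "\<lambda>\<omega>. \<lambda>j\<in>{i}. Z j \<omega>"
  have "indep_var (\<Pi>\<^sub>M j\<in>J. N) ?A (\<Pi>\<^sub>M j\<in>{i}. N) ?B"
    by (rule indep_var_restrict[OF ind]) (use J in auto)
  then have [measurable]: "?A \<in> M \<rightarrow>\<^sub>M (\<Pi>\<^sub>M j\<in>J. N)" "?B \<in> M \<rightarrow>\<^sub>M (\<Pi>\<^sub>M j\<in>{i}. N)"
    and eq: "distr M (\<Pi>\<^sub>M j\<in>J. N) ?A \<Otimes>\<^sub>M distr M (\<Pi>\<^sub>M j\<in>{i}. N) ?B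
      = distr M ((\<Pi>\<^sub>M j\<in>J. N) \<Otimes>\<^sub>M (\<Pi>\<^sub>M j\<in>{i}. N)) (\<lambda>\<omega>. (?A \<omega>, ?B \<omega>))"
    unfolding indep_var_distribution_eq by auto
  have g[measurable]: "(\<lambda>p. p i) \<in> (\<Pi>\<^sub>M j\<in>{i}. N) \<rightarrow>\<^sub>M N"
    using measurable_component_singleton[of i "{i}" "\<lambda>_. N"] by simp
  have A: "distr M L (\<lambda>\<omega>. f (?A \<omega>)) = distr (distr M (\<Pi>\<^sub>M j\<in>J. N) ?A) L f"
    by (subst distr_distr) (auto simp: comp_def)
  have B: "distr M N (Z i) = distr (distr M (\<Pi>\<^sub>M j\<in>{i}. N) ?B) N (\<lambda>p. p i)"
    by (subst distr_distr) (auto simp: comp_def)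
  have "sigma_finite_measure (distr (distr M (\<Pi>\<^sub>M j\<in>{i}. N) ?B) N (\<lambda>p. p i))"
    by (intro prob_space_imp_sigma_finite prob_space.prob_space_distr prob_space_distr) auto
  then have "distr M L (\<lambda>\<omega>. f (?A \<omega>)) \<Otimes>\<^sub>M distr M N (Z i)
    = distr (distr M ((\<Pi>\<^sub>M j\<in>J. N) \<Otimes>\<^sub>M (\<Pi>\<^sub>M j\<in>{i}. N)) (\<lambda>\<omega>. (?A \<omega>, ?B \<omega>))) (L \<Otimes>\<^sub>M N) (\<lambda>(x, y). (f x, y i))"
    unfolding A B eq[symmetric] by (intro pair_measure_distr) auto
  also have "\<dots> = distr M (L \<Otimes>\<^sub>M N) (\<lambda>\<omega>. (f (?A \<omega>), Z i \<omega>))"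
    by (subst distr_distr) (auto simp: comp_def)
  finally show ?thesis .
qed

text \<open>\<open>path_chain p n t m\<close> evaluates \<open>p (n + 1)\<close> at \<open>t\<close>, then \<open>p n\<close>, \<open>p (n - 1)\<close>, \<dots>, \<open>p (n - m + 1)\<close>
  at the preceding value.\<close>

primrec path_chain :: "(nat \<Rightarrow> real \<Rightarrow> real) \<Rightarrow> nat \<Rightarrow> real \<Rightarrow> nat \<Rightarrow> real" where
  "path_chain p n t 0 = path_at t (p (Suc n))"
| "path_chain p n t (Suc m) = path_at (path_chain p n t m) (p (n - m))"

lemma chain_cong:
  "m \<le> n \<Longrightarrow> (\<And>i. n - m < i \<Longrightarrow> i \<le> Suc n \<Longrightarrow> p i = p' i) \<Longrightarrow> path_chain p n t m = path_chain p' n t m"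
proof (induction m)
  case (Suc m)
  have "path_chain p n t m = path_chain p' n t m"
    using Suc.prems by (intro Suc.IH) auto
  then show ?case using Suc.prems by auto
qed simp

lemma measurable_chain:
  "m \<le> n \<Longrightarrow> {n - m<..Suc n} \<subseteq> J \<Longrightarrow>
    (\<lambda>p. path_chain p n t m) \<in> (\<Pi>\<^sub>M i\<in>J. path_space) \<rightarrow>\<^sub>M borel"
proof (induction m)
  case 0
  have "(\<lambda>p. (t, p (Suc n))) \<in> (\<Pi>\<^sub>M i\<in>J. path_space) \<rightarrow>\<^sub>M borel \<Otimes>\<^sub>M path_space"
    using 0 by (intro measurable_Pair measurable_const measurable_component_singleton) auto
  from measurable_compose[OF this measurable_path_at] show ?case by simp
next
  case (Suc m)
  have "n - m \<in> {n - Suc m<..Suc n}" "{n - m<..Suc n} \<subseteq> {n - Suc m<..Suc n}"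
    using Suc.prems(1) by auto
  then have "n - m \<in> J" "{n - m<..Suc n} \<subseteq> J"
    using Suc.prems(2) by blast+
  then have "(\<lambda>p. (path_chain p n t m, p (n - m))) \<in> (\<Pi>\<^sub>M i\<in>J. path_space) \<rightarrow>\<^sub>M borel \<Otimes>\<^sub>M path_space"
    using Suc by (intro measurable_Pair measurable_component_singleton) auto
  from measurable_compose[OF this measurable_path_at] show ?case by simp
qed

text \<open>The recursion wraps the test function: the process evaluated last acts on
  \<open>\<phi>\<close> directly, while the one evaluated first, \<open>X (Suc n)\<close>, stays
  outermost.\<close>

primrec iter_path_mean :: "'a measure \<Rightarrow> (nat \<Rightarrow> real \<Rightarrow> 'a \<Rightarrow> real) \<Rightarrow> nat \<Rightarrow> nat \<Rightarrow> (real \<Rightarrow> ennreal) \<Rightarrow> real \<Rightarrow> ennreal" where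
  "iter_path_mean P X n 0 \<phi> = path_mean P (X (Suc n)) \<phi>"
| "iter_path_mean P X n (Suc m) \<phi> = iter_path_mean P X n m (path_mean P (X (n - m)) \<phi>)"

lemma indep_paths_measurable:
  assumes "prob_space P" "prob_space.indep_vars P (\<lambda>_. path_space) (\<lambda>i. sample_path (X i)) I" "i \<in> I"
  shows "sample_path (X i) \<in> P \<rightarrow>\<^sub>M path_space"
proof -
  interpret prob_space P by fact
  show ?thesis using assms(2,3) by (auto simp: indep_vars_def)
qed

lemma measurable_chain_paths:
  assumes "prob_space P" and ind: "prob_space.indep_vars P (\<lambda>_. path_space) (\<lambda>i. sample_path (X i)) {0..Suc n}"
    and m: "m \<le> Suc n"
  shows "(\<lambda>\<omega>. path_chain (\<lambda>i. sample_path (X i) \<omega>) n t m) \<in> borel_measurable P"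
  using m
proof (induction m)
  case 0
  have "(\<lambda>\<omega>. (t, sample_path (X (Suc n)) \<omega>)) \<in> P \<rightarrow>\<^sub>M borel \<Otimes>\<^sub>M path_space"
    by (intro measurable_Pair measurable_const indep_paths_measurable[OF assms(1) ind]) auto
  from measurable_compose[OF this measurable_path_at] show ?case by (simp only: path_chain.simps prod.case)
next
  case (Suc m)
  have "(\<lambda>\<omega>. (path_chain (\<lambda>i. sample_path (X i) \<omega>) n t m, sample_path (X (n - m)) \<omega>)) \<in> P \<rightarrow>\<^sub>M borel \<Otimes>\<^sub>M path_space"
    using Suc by (intro measurable_Pair indep_paths_measurable[OF assms(1) ind]) auto
  from measurable_compose[OF this measurable_path_at] show ?case by (simp only: path_chain.simps prod.case)
qed

text \<open>After \<open>m\<close> steps the chain has used only indices above \<open>n - m\<close>,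
  so it is independent of the path read next. The case \<open>m = n\<close> reaches index 0.\<close>

lemma nn_integral_chain_Suc:
  assumes "prob_space P" and ind: "prob_space.indep_vars P (\<lambda>_. path_space) (\<lambda>i. sample_path (X i)) {0..Suc n}"
    and m: "m \<le> n" and \<phi>: "\<phi> \<in> borel_measurable borel"
  shows "(\<integral>\<^sup>+\<omega>. \<phi> (path_chain (\<lambda>i. sample_path (X i) \<omega>) n t (Suc m)) \<partial>P)
    = (\<integral>\<^sup>+\<omega>. path_mean P (X (n - m)) \<phi> (path_chain (\<lambda>i. sample_path (X i) \<omega>) n t m) \<partial>P)"
proof -
  interpret prob_space P by fact
  let ?J = "{n - m<..Suc n}"
  have "path_chain (\<lambda>i. sample_path (X i) \<omega>) n t m = path_chain (\<lambda>i\<in>?J. sample_path (X i) \<omega>) n t m" for \<omega>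
    using m by (intro chain_cong) auto
  moreover have "(\<lambda>p. path_chain p n t m) \<in> (\<Pi>\<^sub>M i\<in>?J. path_space) \<rightarrow>\<^sub>M borel"
    using m by (intro measurable_chain) auto
  from indep_vars_pair_law[OF ind _ _ _ this, of "n - m"] m
  have "distr P borel (\<lambda>\<omega>. path_chain (\<lambda>i\<in>?J. sample_path (X i) \<omega>) n t m) \<Otimes>\<^sub>M distr P path_space (sample_path (X (n - m)))
    = distr P (borel \<Otimes>\<^sub>M path_space) (\<lambda>\<omega>. (path_chain (\<lambda>i\<in>?J. sample_path (X i) \<omega>) n t m, sample_path (X (n - m)) \<omega>))"
    by (metis (no_types, lifting) atLeastAtMost_iff diff_le_self greaterThanAtMost_iff le_SucI le0 less_irrefl subsetI)
  ultimately show ?thesis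
    using m unfolding path_chain.simps
    by (intro nn_integral_random_time[OF assms(1) measurable_chain_paths[OF assms(1) ind]
        indep_paths_measurable[OF assms(1) ind] _ \<phi>]) auto
qed

lemma nn_integral_chain:
  assumes "prob_space P" and ind: "prob_space.indep_vars P (\<lambda>_. path_space) (\<lambda>i. sample_path (X i)) {0..Suc n}"
    and m: "m \<le> n" and \<phi>: "\<phi> \<in> borel_measurable borel"
  shows "(\<integral>\<^sup>+\<omega>. \<phi> (path_chain (\<lambda>i. sample_path (X i) \<omega>) n t m) \<partial>P) = iter_path_mean P X n m \<phi> t"
  using m \<phi>
proof (induction m arbitrary: \<phi>)
  case 0
  show ?case by (simp only: path_chain.simps iter_path_mean.simps path_mean_def)
next
  case (Suc m)
  have "path_mean P (X (n - m)) \<phi> \<in> borel_measurable borel"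
    using Suc.prems by (intro borel_measurable_path_mean assms(1) indep_paths_measurable[OF assms(1) ind]) auto
  with Suc show ?case
    by (subst nn_integral_chain_Suc[OF assms(1) ind]) auto
qed

text \<open>An invariant: after \<open>m\<close> steps, the remaining composition of
  \<open>H 1\<close> to \<open>H (n - m)\<close> is applied to the current chain value.
  Nonnegativity is carried along because \<open>path_at\<close> equals evaluation only at
  nonnegative times.\<close>

lemma iterated_process_chain:
  assumes H: "\<And>i. 1 \<le> i \<Longrightarrow> i \<le> n \<Longrightarrow> right_cont (\<lambda>t. H i t \<omega>) \<and> (\<forall>t. 0 \<le> H i t \<omega>)"
    and p: "\<And>i. 1 \<le> i \<Longrightarrow> i \<le> n \<Longrightarrow> p i = sample_path (H i) \<omega>"
    and y: "path_chain p n t 0 = y" "0 \<le> y" and m: "m \<le> n"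
  shows "iterated_process H n y \<omega> = iterated_process H (n - m) (path_chain p n t m) \<omega> \<and> 0 \<le> path_chain p n t m"
  using m
proof (induction m)
  case 0
  then show ?case using y by simp
next
  case (Suc m)
  then obtain k where k: "n - m = Suc k" "n - Suc m = k"
    by (metis Suc_diff_Suc Suc_le_lessD)
  then have "1 \<le> n - m" "n - m \<le> n" by auto
  from H[OF this] p[OF this] Suc
  have "path_chain p n t (Suc m) = H (n - m) (path_chain p n t m) \<omega>" "0 \<le> path_chain p n t (Suc m)"
    by (auto simp: path_at_eq path_at_path)
  then show ?case using Suc k by simp
qed

text \<open>The factorial in the moments cancels that of the exponential series, leaving a
  Mittag-Leffler majorant; absolute convergence then lets the expectation pass through the
  sum.\<close>

lemma poisson_prob_expectation_sums:
  fixes Z :: "'a \<Rightarrow> real"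
  assumes "prob_space P" and Z[measurable]: "Z \<in> borel_measurable P" and nonneg: "AE \<omega> in P. 0 \<le> Z \<omega>"
    and c: "c > 0" and \<alpha>: "\<alpha> > 0" and t: "t > 0"
    and mom: "\<And>j. (\<integral>\<^sup>+\<omega>. ennreal (Z \<omega> ^ j) \<partial>P) = ennreal (fact j * t powr (\<alpha> * real j) / Gamma (1 + \<alpha> * real j))"
  shows "(\<lambda>j. poisson_coeff c k j * t powr (\<alpha> * real j) / Gamma (1 + \<alpha> * real j)) sums (\<integral>\<omega>. poisson_prob c k (Z \<omega>) \<partial>P)"
proof -
  interpret prob_space P by fact
  define m where "m j = fact j * t powr (\<alpha> * real j) / Gamma (1 + \<alpha> * real j)" for j
  have Gpos: "Gamma (1 + \<alpha> * real j) > 0" for j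
    using \<alpha> by (intro Gamma_real_pos add_pos_nonneg) auto
  have m0: "m j \<ge> 0" for j
    using less_imp_le[OF Gpos[of j]] unfolding m_def by (intro divide_nonneg_nonneg mult_nonneg_nonneg) auto
  have bi: "has_bochner_integral P (\<lambda>\<omega>. Z \<omega> ^ j) (m j)" for j
  proof (rule has_bochner_integral_nn_integral)
    show "AE \<omega> in P. 0 \<le> Z \<omega> ^ j"
      using nonneg by eventually_elim simp
    show "(\<integral>\<^sup>+\<omega>. ennreal (Z \<omega> ^ j) \<partial>P) = ennreal (m j)"
      unfolding m_def by (rule mom)
  qed (auto intro: m0)
  let ?f = "\<lambda>j \<omega>. poisson_coeff c k j * Z \<omega> ^ j / fact j"
  have fi: "has_bochner_integral P (?f j) (poisson_coeff c k j * m j / fact j)" for j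
    by (intro has_bochner_integral_divide_zero has_bochner_integral_mult_right bi)
  have nf: "has_bochner_integral P (\<lambda>\<omega>. norm (?f j \<omega>)) (\<bar>poisson_coeff c k j\<bar> * m j / fact j)" for j
  proof -
    have "has_bochner_integral P (\<lambda>\<omega>. \<bar>poisson_coeff c k j\<bar> * Z \<omega> ^ j / fact j) (\<bar>poisson_coeff c k j\<bar> * m j / fact j)"
      by (intro has_bochner_integral_divide_zero has_bochner_integral_mult_right bi)
    moreover have "AE \<omega> in P. \<bar>poisson_coeff c k j\<bar> * Z \<omega> ^ j / fact j = norm (?f j \<omega>)"
      using nonneg by eventually_elim (simp add: abs_mult)
    moreover have "(\<lambda>\<omega>. \<bar>poisson_coeff c k j\<bar> * Z \<omega> ^ j / fact j) \<in> borel_measurable P"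
      "(\<lambda>\<omega>. norm (?f j \<omega>)) \<in> borel_measurable P"
      by measurable
    ultimately show ?thesis
      using has_bochner_integral_cong_AE by blast
  qed
  have val: "poisson_coeff c k j * m j / fact j = poisson_coeff c k j * t powr (\<alpha> * real j) / Gamma (1 + \<alpha> * real j)" for j
    by (simp add: m_def)
  have le: "\<bar>poisson_coeff c k j\<bar> * m j / fact j \<le> (2 * c * t powr \<alpha>) ^ j / Gamma (1 + \<alpha> * real j)" for j
  proof -
    have "\<bar>poisson_coeff c k j\<bar> * m j / fact j = \<bar>poisson_coeff c k j\<bar> * (t powr \<alpha>) ^ j / Gamma (1 + \<alpha> * real j)"
      using t by (simp add: m_def powr_powr[symmetric] powr_realpow)
    also have "\<dots> \<le> (2 * c) ^ j * (t powr \<alpha>) ^ j / Gamma (1 + \<alpha> * real j)"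
      using less_imp_le[OF Gpos[of j]] poisson_coeff_bound[OF c, of k j]
      by (intro divide_right_mono mult_right_mono) auto
    finally show ?thesis by (simp add: power_mult_distrib)
  qed
  have "(\<lambda>j. integral\<^sup>L P (?f j)) sums (\<integral>\<omega>. (\<Sum>j. ?f j \<omega>) \<partial>P)"
  proof (rule sums_integral)
    show "integrable P (?f j)" for j using fi by (rule integrable.intros)
    show "AE \<omega> in P. summable (\<lambda>j. norm (?f j \<omega>))"
    proof (rule AE_I2)
      fix \<omega>
      show "summable (\<lambda>j. norm (?f j \<omega>))"
      proof (rule summable_comparison_test'[OF summable_exp[of "2 * c * \<bar>Z \<omega>\<bar>"], of 0])
        fix j
        have "norm (norm (?f j \<omega>)) = inverse (fact j) * (\<bar>poisson_coeff c k j\<bar> * \<bar>Z \<omega>\<bar> ^ j)"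
          by (simp add: abs_mult power_abs divide_inverse)
        also have "\<dots> \<le> inverse (fact j) * ((2 * c) ^ j * \<bar>Z \<omega>\<bar> ^ j)"
          using poisson_coeff_bound[OF c, of k j] by (intro mult_left_mono mult_right_mono) auto
        finally show "norm (norm (?f j \<omega>)) \<le> inverse (fact j) * (2 * c * \<bar>Z \<omega>\<bar>) ^ j"
          by (simp add: power_mult_distrib)
      qed
    qed
    show "summable (\<lambda>j. \<integral>\<omega>. norm (?f j \<omega>) \<partial>P)"
      unfolding has_bochner_integral_integral_eq[OF nf]
      by (rule summable_comparison_test'[OF summable_mittag_leffler[OF \<alpha>], of 0])
         (use le m0 in \<open>simp add: abs_mult\<close>)
  qed
  moreover have "(\<Sum>j. ?f j \<omega>) = poisson_prob c k (Z \<omega>)" for \<omega>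
    using poisson_prob_sums by (rule sums_unique[symmetric])
  ultimately show ?thesis
    unfolding has_bochner_integral_integral_eq[OF fi] val by simp
qed

text \<open>Index \<open>Suc n\<close> is the inverse applied first, index 1 the last.
  \<open>X 0\<close> is constrained only by independence; it is the slot for the Poisson process.
  General indices \<open>b i\<close> treat the factors 1/2 and \<open>\<beta>\<close> alike.\<close>

locale inverse_chain = prob_space M for M :: "'a measure" +
  fixes G :: "nat \<Rightarrow> real \<Rightarrow> 'a \<Rightarrow> real" and b :: "nat \<Rightarrow> real" and X n
  assumes stable: "\<And>i. 1 \<le> i \<Longrightarrow> i \<le> Suc n \<Longrightarrow> stable_subordinator M (b i) (G i)"
    and X: "\<And>i. 1 \<le> i \<Longrightarrow> i \<le> Suc n \<Longrightarrow> X i = inverse_process (G i)"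
    and indep: "prob_space.indep_vars (completion M) (\<lambda>_. path_space) (\<lambda>i. sample_path (X i)) {0..Suc n}"
begin

lemma prob_completion: "prob_space (completion M)"
  by (rule prob_space_completion)

lemma path_measurable: "i \<le> Suc n \<Longrightarrow> sample_path (X i) \<in> completion M \<rightarrow>\<^sub>M path_space"
  by (rule indep_paths_measurable[OF prob_completion indep]) auto

lemma borel_measurable_iter_path_mean:
  "m \<le> n \<Longrightarrow> \<phi> \<in> borel_measurable borel \<Longrightarrow> iter_path_mean (completion M) X n m \<phi> \<in> borel_measurable borel"
proof (induction m arbitrary: \<phi>)
  case 0
  then show ?case by (simp add: borel_measurable_path_mean[OF prob_completion path_measurable])
next
  case (Suc m)
  then show ?case by (simp add: borel_measurable_path_mean[OF prob_completion path_measurable])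
qed

lemma mono_iter_path_mean:
  "m \<le> n \<Longrightarrow> mono_on {0..} \<phi> \<Longrightarrow> mono_on {0..} (iter_path_mean (completion M) X n m \<phi>)"
proof (induction m arbitrary: \<phi>)
  case 0
  then show ?case using path_mean_inverse_mono[OF prob_space_axioms stable] by (simp add: X)
next
  case (Suc m)
  then have "1 \<le> n - m" "n - m \<le> Suc n" by auto
  then have "mono_on {0..} (path_mean (completion M) (X (n - m)) \<phi>)"
    using path_mean_inverse_mono[OF prob_space_axioms stable] Suc.prems by (simp add: X)
  then show ?case using Suc by simp
qed

lemma laplace_iter_path_mean:
  "m \<le> n \<Longrightarrow> \<phi> \<in> borel_measurable borel \<Longrightarrow> s > 0 \<Longrightarrow>
    laplace (iter_path_mean (completion M) X n m \<phi>) s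
      = ennreal (s powr ((\<Prod>i\<in>{n - m<..Suc n}. b i) - 1)) * laplace \<phi> (s powr (\<Prod>i\<in>{n - m<..Suc n}. b i))"
proof (induction m arbitrary: \<phi>)
  case 0
  have "{n<..Suc n} = {Suc n}" by auto
  moreover have X': "X (Suc n) = inverse_process (G (Suc n))"
    by (rule X) auto
  have "laplace (path_mean (completion M) (X (Suc n)) \<phi>) s
    = ennreal (s powr (b (Suc n) - 1)) * laplace \<phi> (s powr b (Suc n))"
    unfolding X'
    by (rule laplace_path_mean_inverse[OF prob_space_axioms stable])
       (use 0 path_measurable[of "Suc n"] X' in auto)
  ultimately show ?case by simp
next
  case (Suc m)
  let ?a = "\<Prod>i\<in>{n - m<..Suc n}. b i" and ?i = "n - m"
  have i: "1 \<le> ?i" "?i \<le> Suc n" using Suc.prems by auto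
  have "{n - Suc m<..Suc n} = insert ?i {?i<..Suc n}" using Suc.prems by auto
  then have p: "(\<Prod>i\<in>{n - Suc m<..Suc n}. b i) = b ?i * ?a" by simp
  have mm: "path_mean (completion M) (X ?i) \<phi> \<in> borel_measurable borel"
    using Suc.prems i by (intro borel_measurable_path_mean[OF prob_completion path_measurable]) auto
  have "laplace (path_mean (completion M) (X ?i) \<phi>) (s powr ?a)
    = ennreal ((s powr ?a) powr (b ?i - 1)) * laplace \<phi> ((s powr ?a) powr b ?i)"
    unfolding X[OF i]
    by (rule laplace_path_mean_inverse[OF prob_space_axioms stable[OF i]])
       (use Suc.prems path_measurable[OF i(2)] X[OF i] in auto)
  with Suc.IH[OF _ mm] Suc.prems
  have "laplace (iter_path_mean (completion M) X n (Suc m) \<phi>) s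
    = ennreal (s powr (?a - 1)) * (ennreal ((s powr ?a) powr (b ?i - 1)) * laplace \<phi> ((s powr ?a) powr b ?i))"
    by simp
  also have "\<dots> = ennreal (s powr (?a - 1) * (s powr ?a) powr (b ?i - 1)) * laplace \<phi> ((s powr ?a) powr b ?i)"
    by (simp add: ennreal_mult' mult.assoc)
  \<comment> \<open>The prefactor reproduces itself:
    \<open>?a - 1 + ?a * (b ?i - 1) = b ?i * ?a - 1\<close>.\<close>
  also have "s powr (?a - 1) * (s powr ?a) powr (b ?i - 1) = s powr (b ?i * ?a - 1)"
    by (simp add: powr_powr powr_add[symmetric] algebra_simps)
  also have "(s powr ?a) powr b ?i = s powr (b ?i * ?a)"
    by (simp add: powr_powr mult.commute)
  finally show ?case unfolding p .
qed

text \<open>The transform of the j-th power at \<open>s powr \<alpha>\<close> is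
  \<open>fact j / s powr (\<alpha> * (j + 1))\<close>; the prefactor
  \<open>s powr (\<alpha> - 1)\<close> makes it \<open>fact j / s powr (1 + \<alpha> * j)\<close>,
  the transform of a power of \<open>t\<close>.\<close>

lemma chain_moments:
  assumes \<alpha>: "\<alpha> = (\<Prod>i\<in>{1..Suc n}. b i)" "\<alpha> > 0" and t: "t > 0"
  shows "iter_path_mean (completion M) X n n (\<lambda>x. ennreal (max 0 x ^ j)) t = ennreal (fact j * t powr (\<alpha> * real j) / Gamma (1 + \<alpha> * real j))"
proof -
  have pos: "1 + \<alpha> * real j > 0" using \<alpha>(2) by (intro add_pos_nonneg) auto
  have int: "{n - n<..Suc n} = {1..Suc n}" by auto
  have "iter_path_mean (completion M) X n n (\<lambda>x. ennreal (max 0 x ^ j)) t = ennreal (fact j * t powr (1 + \<alpha> * real j - 1) / Gamma (1 + \<alpha> * real j))"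
  proof (rule laplace_powr_inverse)
    show "iter_path_mean (completion M) X n n (\<lambda>x. ennreal (max 0 x ^ j)) \<in> borel_measurable borel"
      by (rule borel_measurable_iter_path_mean) auto
    show "mono_on {0..} (iter_path_mean (completion M) X n n (\<lambda>x. ennreal (max 0 x ^ j)))"
      by (rule mono_iter_path_mean) (auto intro!: mono_onI ennreal_leI power_mono)
    fix s :: real assume s: "s > 0"
    have "laplace (iter_path_mean (completion M) X n n (\<lambda>x. ennreal (max 0 x ^ j))) s
      = ennreal (s powr (\<alpha> - 1)) * laplace (\<lambda>x. ennreal (max 0 x ^ j)) (s powr \<alpha>)"
      unfolding \<alpha>(1) int[symmetric] by (rule laplace_iter_path_mean) (use s in auto)
    also have "laplace (\<lambda>x. ennreal (max 0 x ^ j)) (s powr \<alpha>) = laplace (\<lambda>x. ennreal (x powr (real (Suc j) - 1))) (s powr \<alpha>)"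
      by (rule laplace_cong) (simp add: powr_realpow max_def)
    also have "\<dots> = ennreal (Gamma (real (Suc j)) / (s powr \<alpha>) powr real (Suc j))"
      by (rule laplace_powr) (use s in auto)
    also have "Gamma (real (Suc j)) = fact j"
      using Gamma_fact[of j, where 'a = real] by (simp add: add.commute)
    also have "ennreal (s powr (\<alpha> - 1)) * ennreal (fact j / (s powr \<alpha>) powr real (Suc j))
      = ennreal (fact j * (s powr (\<alpha> - 1) / (s powr \<alpha>) powr real (Suc j)))"
      by (simp flip: ennreal_mult')
    also have "s powr (\<alpha> - 1) / (s powr \<alpha>) powr real (Suc j) = 1 / s powr (1 + \<alpha> * real j)"
      by (simp add: powr_powr powr_diff[symmetric] powr_minus_divide[symmetric] algebra_simps)
    finally show "laplace (iter_path_mean (completion M) X n n (\<lambda>x. ennreal (max 0 x ^ j))) s = ennreal (fact j / s powr (1 + \<alpha> * real j))"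
      by simp
  qed (use pos t in auto)
  then show ?thesis by simp
qed

end

subsection \<open>The Poisson process at the composed time\<close>

lemma levy_process_right_cont:
  assumes "levy_process M X"
  shows "AE \<omega> in M. right_cont (\<lambda>t. X t \<omega>)"
proof -
  have "AE \<omega> in M. cadlag (\<lambda>t. X t \<omega>)" using assms by (simp add: levy_process_def)
  then show ?thesis by eventually_elim (simp add: cadlag_def right_cont_def)
qed

lemma path_mean_poisson_process:
  assumes N: "poisson_process M c N" and y: "y \<ge> 0" and M: "prob_space M"
  shows "path_mean (completion M) (\<lambda>t \<omega>. real (N t \<omega>)) (indicator {real k}) y = ennreal (poisson_prob c k y)"
proof -
  interpret prob_space M by fact
  have L: "levy_process M (\<lambda>t \<omega>. real (N t \<omega>))" using N by (simp add: poisson_process_def)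
  have "(\<lambda>\<omega>. real (N y \<omega>)) \<in> borel_measurable M"
    using L y by (simp add: levy_process_def)
  then have m: "{\<omega> \<in> space M. N y \<omega> = k} \<in> sets M"
    using measurable_sets[of "\<lambda>\<omega>. real (N y \<omega>)" M borel "{real k}"]
    by (simp add: vimage_def Int_def conj_commute)
  have "path_mean (completion M) (\<lambda>t \<omega>. real (N t \<omega>)) (indicator {real k}) y
    = (\<integral>\<^sup>+\<omega>. indicator {real k} (real (N y \<omega>)) \<partial>M)"
    by (subst path_mean_eq[OF AE_completion[OF levy_process_right_cont[OF L]] y]) (rule nn_integral_completion)
  also have "\<dots> = (\<integral>\<^sup>+\<omega>. indicator {\<omega> \<in> space M. N y \<omega> = k} \<omega> \<partial>M)"
    by (rule nn_integral_cong) (auto simp: indicator_def)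
  also have "\<dots> = ennreal (measure M {\<omega> \<in> space M. N y \<omega> = k})"
    using m by (simp add: emeasure_eq_measure)
  also have "measure M {\<omega> \<in> space M. N y \<omega> = k} = poisson_prob c k y"
    using N y by (simp add: poisson_process_def)
  finally show ?thesis .
qed

theorem proposition3p2:
  fixes M :: "'a measure"
    and c \<beta> :: real
    and n :: nat
    and N :: "real \<Rightarrow> 'a \<Rightarrow> nat"
    and G H :: "nat \<Rightarrow> real \<Rightarrow> 'a \<Rightarrow> real"
    and D E :: "real \<Rightarrow> 'a \<Rightarrow> real"
    and q :: "nat \<Rightarrow> real \<Rightarrow> real"
    and U :: "real \<Rightarrow> real"
  assumes M: "prob_space M"
    and c: "c > 0"
    and n: "n \<ge> 1"
    and \<beta>: "0 < \<beta>" "\<beta> < 1"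
    and N: "poisson_process M c N"
    and G: "\<And>i. i \<in> {1..n} \<Longrightarrow> stable_subordinator M (1/2) (G i)"
    and H: "H = (\<lambda>i. inverse_process (G i))"
    and D: "stable_subordinator M \<beta> D"
    and E: "E = inverse_process D"
    and indep: "independent_processes M
      (\<lambda>i. if i = 0 then (\<lambda>t \<omega>. real (N t \<omega>)) else if i \<le> n then H i else E) {0..n + 1}"
    and q: "\<And>k t. q k t =
      measure (completion M) {\<omega> \<in> space M. N (iterated_process H n (E t \<omega>) \<omega>) \<omega> = k}"
    and U: "\<And>\<gamma>. U \<gamma> = (\<integral>\<omega>. D 1 \<omega> powr (\<gamma> * \<beta>) \<partial>M)"
  shows "\<forall>k. \<forall>t>0.
    caputo_differentiable \<beta> (q k) t \<and>
    caputo_deriv \<beta> (q k) t =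
      c ^ (2 ^ n) * (one_minus_shift ^^ (2 ^ n)) (\<lambda>i. q i t) k
      + (\<Sum>j = 1..2 ^ n - 1. (deriv ^^ j) (\<lambda>z. poisson_prob c k z) 0 *
          (t powr (- \<beta> * (2 ^ n - real j) / 2 ^ n) * U ((2 ^ n - real j) / 2 ^ n)
            / Gamma (1 - (2 ^ n - real j) / 2 ^ n)))"
proof -
  interpret prob_space M by fact
  interpret P: prob_space "completion M" by (rule prob_space_completion)
  define X where "X = (\<lambda>i::nat. if i = 0 then (\<lambda>t \<omega>. real (N t \<omega>)) else if i \<le> n then H i else E)"
  define G' where "G' i = (if i \<le> n then G i else D)" for i
  define b where "b i = (if i \<le> n then 1 / 2 else \<beta>)" for i
  define \<alpha> where "\<alpha> = \<beta> / 2 ^ n"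
  have \<alpha>: "\<alpha> > 0" "\<beta> = \<alpha> * real (2 ^ n)" using \<beta> by (auto simp: \<alpha>_def)
  have ind: "P.indep_vars (\<lambda>_. path_space) (\<lambda>i. sample_path (X i)) {0..Suc n}"
    using indep by (simp add: independent_processes_def X_def sample_path_def[abs_def])
  interpret C: inverse_chain M G' b X n
  proof
    show "stable_subordinator M (b i) (G' i)" if "1 \<le> i" "i \<le> Suc n" for i
      using that G D by (auto simp: b_def G'_def)
    show "X i = inverse_process (G' i)" if "1 \<le> i" "i \<le> Suc n" for i
      using that by (auto simp: X_def G'_def H E)
  qed (rule ind)
  have \<alpha>_prod: "\<alpha> = (\<Prod>i\<in>{1..Suc n}. b i)"
  proof -
    have "(\<Prod>i\<in>{1..Suc n}. b i) = (\<Prod>i\<in>{1..n}. 1 / 2) * \<beta>"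
      unfolding prod.nat_ivl_Suc'[OF le_SucI[OF n]] by (auto simp: b_def intro!: prod.cong)
    then show ?thesis by (simp add: \<alpha>_def power_divide)
  qed

  let ?p = "\<lambda>\<omega> i. sample_path (X i) \<omega>"
  let ?Z = "\<lambda>t \<omega>. path_chain (?p \<omega>) n t n"
  \<comment> \<open>One exceptional null set, independent of \<open>t\<close>, for all regularity of
    paths; off it the chain of evaluations is the literal composition at every positive
    time.\<close>
  have good: "AE \<omega> in completion M. (\<forall>i\<in>{1..Suc n}. subordinator_path (\<lambda>t. G' i t \<omega>)) \<and> right_cont (\<lambda>t. real (N t \<omega>))"
  proof -
    have "AE \<omega> in M. \<forall>i\<in>{1..Suc n}. subordinator_path (\<lambda>t. G' i t \<omega>)"
      by (rule AE_finite_allI) (auto intro!: stable_subordinator_paths[OF M C.stable])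
    moreover have "AE \<omega> in M. right_cont (\<lambda>t. real (N t \<omega>))"
      using N by (intro levy_process_right_cont) (simp add: poisson_process_def)
    ultimately show ?thesis by (intro AE_completion) auto
  qed
  have Z: "0 \<le> ?Z t \<omega> \<and> iterated_process H n (E t \<omega>) \<omega> = ?Z t \<omega> \<and>
      path_chain (?p \<omega>) n t (Suc n) = real (N (iterated_process H n (E t \<omega>) \<omega>) \<omega>)"
    if t: "t > 0" and g: "(\<forall>i\<in>{1..Suc n}. subordinator_path (\<lambda>t. G' i t \<omega>)) \<and> right_cont (\<lambda>t. real (N t \<omega>))" for t \<omega>
  proof -
    have s: "subordinator_path (\<lambda>t. G' i t \<omega>)" if "1 \<le> i" "i \<le> Suc n" for i
      using g that by auto
    have HX: "X i = H i \<and> H i = inverse_process (G' i)" if "1 \<le> i" "i \<le> n" for i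
      using that by (auto simp: X_def H G'_def)
    have EX: "X (Suc n) = E" "E = inverse_process (G' (Suc n))"
      by (auto simp: X_def E G'_def)
    have c0: "path_chain (?p \<omega>) n t 0 = E t \<omega>" "0 \<le> E t \<omega>"
      using t s[of "Suc n"] inverse_process_path(1,2)[of "G' (Suc n)" \<omega>]
      by (auto simp: path_at_path path_at_eq EX)
    have "iterated_process H n (E t \<omega>) \<omega> = iterated_process H (n - n) (?Z t \<omega>) \<omega> \<and> 0 \<le> ?Z t \<omega>"
    proof (rule iterated_process_chain[OF _ _ c0])
      fix i assume i: "1 \<le> i" "i \<le> n"
      show "right_cont (\<lambda>t. H i t \<omega>) \<and> (\<forall>t. 0 \<le> H i t \<omega>)"
        using HX[OF i] s[of i] i inverse_process_path(1,2)[of "G' i" \<omega>] by auto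
      show "sample_path (X i) \<omega> = sample_path (H i) \<omega>" using HX[OF i] by simp
    qed simp
    then show ?thesis
      using g by (simp add: path_at_path path_at_eq X_def)
  qed
  have Zm[measurable]: "?Z t \<in> borel_measurable (completion M)" for t
    by (rule measurable_chain_paths[OF P.prob_space_axioms ind]) simp
  have Z0: "AE \<omega> in completion M. 0 \<le> ?Z t \<omega>" if "t > 0" for t
    using good by eventually_elim (use Z that in auto)
  have moments: "(\<integral>\<^sup>+\<omega>. ennreal (?Z t \<omega> ^ j) \<partial>completion M)
    = ennreal (fact j * t powr (\<alpha> * real j) / Gamma (1 + \<alpha> * real j))" if t: "t > 0" for t j
  proof -
    have "(\<integral>\<^sup>+\<omega>. ennreal (?Z t \<omega> ^ j) \<partial>completion M) = (\<integral>\<^sup>+\<omega>. ennreal (max 0 (?Z t \<omega>) ^ j) \<partial>completion M)"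
      by (rule nn_integral_cong_AE, use Z0[OF t] in eventually_elim) simp
    also have "\<dots> = iter_path_mean (completion M) X n n (\<lambda>x. ennreal (max 0 x ^ j)) t"
      by (rule nn_integral_chain[OF P.prob_space_axioms ind]) auto
    also have "\<dots> = ennreal (fact j * t powr (\<alpha> * real j) / Gamma (1 + \<alpha> * real j))"
      by (rule C.chain_moments[OF \<alpha>_prod \<alpha>(1) t])
    finally show ?thesis .
  qed
  have q_expect: "q k t = (\<integral>\<omega>. poisson_prob c k (?Z t \<omega>) \<partial>completion M)" if t: "t > 0" for k t
  proof -
    let ?A = "{\<omega> \<in> space M. N (iterated_process H n (E t \<omega>) \<omega>) \<omega> = k}"
    let ?W = "\<lambda>\<omega>. path_chain (?p \<omega>) n t (Suc n)"
    let ?B = "?W -` {real k} \<inter> space (completion M)"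
    have Wm: "?W \<in> borel_measurable (completion M)"
      by (rule measurable_chain_paths[OF P.prob_space_axioms ind]) simp
    then have B: "?B \<in> sets (completion M)" by (rule measurable_sets) simp
    \<comment> \<open>The event in the statement is only almost surely equal to the measurable event
      \<open>?B\<close>; it is the completion that makes it measurable.\<close>
    have AB: "AE \<omega> in completion M. \<omega> \<in> ?B \<longleftrightarrow> \<omega> \<in> ?A"
      using good AE_space by eventually_elim (use Z[OF t] in auto)
    have A: "?A \<in> sets (completion M)"
      by (rule completion.in_sets_AE[OF AB B]) auto
    have "emeasure (completion M) ?A = emeasure (completion M) ?B"
      by (rule emeasure_eq_AE[OF _ A B]) (use AB in auto)
    also have "\<dots> = (\<integral>\<^sup>+\<omega>. indicator ?B \<omega> \<partial>completion M)"
      using B by (rule nn_integral_indicator[symmetric])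
    also have "\<dots> = (\<integral>\<^sup>+\<omega>. indicator {real k} (?W \<omega>) \<partial>completion M)"
      by (rule nn_integral_cong) (auto simp: indicator_def)
    \<comment> \<open>Index \<open>n - n\<close> is 0, the Poisson process, whose kernel at the
      indicator of \<open>k\<close> is \<open>poisson_prob c k\<close>.\<close>
    also have "\<dots> = (\<integral>\<^sup>+\<omega>. path_mean (completion M) (X (n - n)) (indicator {real k}) (?Z t \<omega>) \<partial>completion M)"
      by (rule nn_integral_chain_Suc[OF P.prob_space_axioms ind]) auto
    also have "\<dots> = (\<integral>\<^sup>+\<omega>. ennreal (poisson_prob c k (?Z t \<omega>)) \<partial>completion M)"
      by (rule nn_integral_cong_AE, use Z0[OF t] in eventually_elim)
         (simp add: X_def path_mean_poisson_process[OF N _ M])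
    finally have e: "emeasure (completion M) ?A = (\<integral>\<^sup>+\<omega>. ennreal (poisson_prob c k (?Z t \<omega>)) \<partial>completion M)" .
    have pm: "(\<lambda>\<omega>. poisson_prob c k (?Z t \<omega>)) \<in> borel_measurable (completion M)"
      unfolding poisson_prob_def by measurable
    have "(\<integral>\<omega>. poisson_prob c k (?Z t \<omega>) \<partial>completion M) = enn2real (emeasure (completion M) ?A)"
      unfolding e
    proof (rule integral_eq_nn_integral[OF pm])
      show "AE \<omega> in completion M. 0 \<le> poisson_prob c k (?Z t \<omega>)"
        using Z0[OF t] by eventually_elim (use c in \<open>simp add: poisson_prob_def\<close>)
    qed
    then show ?thesis by (simp add: q measure_def)
  qed
  have q_sums: "(\<lambda>j. poisson_coeff c k j * t powr (\<alpha> * real j) / Gamma (1 + \<alpha> * real j)) sums q k t" if t: "t > 0" for k t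
    unfolding q_expect[OF t]
    by (rule poisson_prob_expectation_sums[OF P.prob_space_axioms Zm Z0[OF t] c \<alpha>(1) t moments[OF t]])

  show ?thesis
  proof (intro allI impI)
    fix k :: nat and t :: real assume t: "t > (0::real)"
    have series: "q k t = (\<Sum>j. poisson_coeff c k j * t powr (\<alpha> * real j) / Gamma (1 + \<alpha> * real j))" if "t > 0" for t
      using q_sums[OF that] by (rule sums_unique)
    note caputo = caputo_deriv_mittag_leffler_series[OF \<alpha>(1) \<beta>(2) \<alpha>(2) _ poisson_coeff_bound[OF c] series t]
    have main: "(\<Sum>j. poisson_coeff c k (j + 2 ^ n) * t powr (\<alpha> * real j) / Gamma (1 + \<alpha> * real j))
      = c ^ (2 ^ n) * (one_minus_shift ^^ (2 ^ n)) (\<lambda>i. q i t) k"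
    proof -
      define x where "x j = t powr (\<alpha> * real j) / Gamma (1 + \<alpha> * real j)" for j
      \<comment> \<open>\<open>n \<ge> 1\<close> makes the exponent \<open>2 ^ n\<close> even, which
        removes the sign.\<close>
      have ev: "(- c) ^ (2 ^ n) = c ^ (2 ^ n)" using n by simp
      have "(\<lambda>j. (one_minus_shift ^^ (2 ^ n)) (\<lambda>k. x j * poisson_coeff c k j) k) sums (one_minus_shift ^^ (2 ^ n)) (\<lambda>i. q i t) k"
        by (rule one_minus_shift_iter_sums) (use q_sums[OF t] in \<open>simp add: x_def mult_ac\<close>)
      then have "(\<lambda>j. c ^ (2 ^ n) * (x j * (one_minus_shift ^^ (2 ^ n)) (\<lambda>k. poisson_coeff c k j) k)) sums
        (c ^ (2 ^ n) * (one_minus_shift ^^ (2 ^ n)) (\<lambda>i. q i t) k)"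
        unfolding one_minus_shift_iter_cmult by (rule sums_mult)
      moreover have "c ^ (2 ^ n) * (x j * (one_minus_shift ^^ (2 ^ n)) (\<lambda>k. poisson_coeff c k j) k)
        = poisson_coeff c k (j + 2 ^ n) * t powr (\<alpha> * real j) / Gamma (1 + \<alpha> * real j)" for j
        unfolding poisson_coeff_add ev x_def by simp
      ultimately show ?thesis by (simp add: sums_iff)
    qed
    have corr: "poisson_coeff c k j * t powr (\<alpha> * real j - \<beta>) / Gamma (1 + \<alpha> * real j - \<beta>)
      = (deriv ^^ j) (\<lambda>z. poisson_prob c k z) 0 *
          (t powr (- \<beta> * (2 ^ n - real j) / 2 ^ n) * U ((2 ^ n - real j) / 2 ^ n)
            / Gamma (1 - (2 ^ n - real j) / 2 ^ n))" if j: "j \<in> {1..2 ^ n - 1}" for j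
    proof -
      \<comment> \<open>With this fraction, \<open>1 - \<gamma> * \<beta>\<close> is the Gamma
        argument of the j-th leftover term. The moment order \<open>\<gamma> * \<beta>\<close> is
        below \<open>\<beta>\<close>, so \<open>stable_fractional_moment\<close> applies.\<close>
      define \<gamma> where "\<gamma> = (2 ^ n - real j) / 2 ^ n"
      have "1 \<le> j" "j < 2 ^ n" using j by auto
      then have "0 < real j" "real j < 2 ^ n"
        by simp_all
      then have \<gamma>: "0 < \<gamma>" "\<gamma> < 1" by (auto simp: \<gamma>_def)
      have e1: "1 + \<alpha> * real j - \<beta> = 1 - \<gamma> * \<beta>" "\<alpha> * real j - \<beta> = - \<beta> * \<gamma>"
        by (simp_all add: \<gamma>_def \<alpha>_def field_simps)
      have "U \<gamma> = Gamma (1 - \<gamma> * \<beta> / \<beta>) / Gamma (1 - \<gamma> * \<beta>)"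
        unfolding U
      proof (rule stable_fractional_moment[OF M])
        show "D 1 \<in> borel_measurable M"
          by (rule stable_subordinator_measurable[OF D]) simp
        show "AE \<omega> in M. 0 \<le> D 1 \<omega>"
          using stable_subordinator_paths[OF M D] by eventually_elim (auto intro: inverse_process_path(6))
        show "(\<integral>\<omega>. exp (- s * D 1 \<omega>) \<partial>M) = exp (- (s powr \<beta>))" if "s \<ge> 0" for s
          using D that by (auto simp: stable_subordinator_def)
      qed (use \<gamma> \<beta> in auto)
      moreover have "Gamma (1 - \<gamma>) > 0" using \<gamma> by (intro Gamma_real_pos) simp
      \<comment> \<open>The \<open>Gamma (1 - \<gamma>)\<close> in the statement cancels the
        numerator of the moment, so each correction is just the leftover coefficient written
        probabilistically.\<close>
      ultimately have "U \<gamma> / Gamma (1 - \<gamma>) = 1 / Gamma (1 - \<gamma> * \<beta>)"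
        using \<beta> by simp
      then have "t powr (- \<beta> * \<gamma>) * U \<gamma> / Gamma (1 - \<gamma>) = t powr (- \<beta> * \<gamma>) * (1 / Gamma (1 - \<gamma> * \<beta>))"
        by (metis times_divide_eq_right)
      then show ?thesis
        unfolding deriv_iter_poisson_prob e1 \<gamma>_def[symmetric] times_divide_eq_right[symmetric, of "- \<beta>"]
        by simp
    qed
    show "caputo_differentiable \<beta> (q k) t \<and>
    caputo_deriv \<beta> (q k) t =
      c ^ (2 ^ n) * (one_minus_shift ^^ (2 ^ n)) (\<lambda>i. q i t) k
      + (\<Sum>j = 1..2 ^ n - 1. (deriv ^^ j) (\<lambda>z. poisson_prob c k z) 0 *
          (t powr (- \<beta> * (2 ^ n - real j) / 2 ^ n) * U ((2 ^ n - real j) / 2 ^ n)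
            / Gamma (1 - (2 ^ n - real j) / 2 ^ n)))"
    proof
      show "caputo_differentiable \<beta> (q k) t" by (rule caputo(1)) auto
      have "caputo_deriv \<beta> (q k) t =
        (\<Sum>j. poisson_coeff c k (j + 2 ^ n) * t powr (\<alpha> * real j) / Gamma (1 + \<alpha> * real j))
        + (\<Sum>j = 1..2 ^ n - 1. poisson_coeff c k j * t powr (\<alpha> * real j - \<beta>) / Gamma (1 + \<alpha> * real j - \<beta>))"
        by (rule caputo(2)) auto
      also note main
      also have "(\<Sum>j = 1..2 ^ n - 1. poisson_coeff c k j * t powr (\<alpha> * real j - \<beta>) / Gamma (1 + \<alpha> * real j - \<beta>))
        = (\<Sum>j = 1..2 ^ n - 1. (deriv ^^ j) (\<lambda>z. poisson_prob c k z) 0 *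
          (t powr (- \<beta> * (2 ^ n - real j) / 2 ^ n) * U ((2 ^ n - real j) / 2 ^ n)
            / Gamma (1 - (2 ^ n - real j) / 2 ^ n)))"
        by (rule sum.cong[OF refl corr])
      finally show "caputo_deriv \<beta> (q k) t =
      c ^ (2 ^ n) * (one_minus_shift ^^ (2 ^ n)) (\<lambda>i. q i t) k
      + (\<Sum>j = 1..2 ^ n - 1. (deriv ^^ j) (\<lambda>z. poisson_prob c k z) 0 *
          (t powr (- \<beta> * (2 ^ n - real j) / 2 ^ n) * U ((2 ^ n - real j) / 2 ^ n)
            / Gamma (1 - (2 ^ n - real j) / 2 ^ n)))" .
    qed
  qed
qed

end
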